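(* Let $H,K$ be two finitely generated subgroups of a free group $F$, and let $\langle H,K\rangle$ denote the subgroup generated by $H$ and $K$. Suppose that neither $H$ nor $K$ has finite index in $\langle H,K\rangle$. Then there is an epimorphism $\zeta:\langle H,K\rangle\to F_2$, where $F_2$ is a free group of rank 2, such that the restriction of $\zeta$ to $H$ is injective, the restriction of $\zeta$ to $K$ is injective, and the restriction $\zeta_0: H\cap K\to \zeta(H)\cap\zeta(K)$ of $\zeta$ to $H\cap K$ is surjective. *)

theory Defs
  imports "HOL-Algebra.Algebra"
begin

text \<open>The letter \<open>(x, True)\<close> stands for the generator \<open>x\<close>,
  and \<open>(x, False)\<close> for its formal inverse.\<close>

definition letter_inv :: "'a \<times> bool \<Rightarrow> 'a \<times> bool" where
  "letter_inv a = (fst a, \<not> snd a)"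

definition reduced :: "('a \<times> bool) list \<Rightarrow> bool" where
  "reduced w \<longleftrightarrow> successively (\<lambda>a b. b \<noteq> letter_inv a) w"

text \<open>Left multiplication of a reduced word by one letter.\<close>

fun push :: "'a \<times> bool \<Rightarrow> ('a \<times> bool) list \<Rightarrow> ('a \<times> bool) list" where
  "push a [] = [a]"
| "push a (b # w) = (if b = letter_inv a then w else a # b # w)"

text \<open>\<open>foldr push u v\<close> is the reduced form of the concatenation \<open>u @ v\<close>
  (for \<open>v\<close> reduced).\<close>

definition free_group :: "'a set \<Rightarrow> ('a \<times> bool) list monoid" where
  "free_group S =
     \<lparr>carrier = {w. fst ` set w \<subseteq> S \<and> reduced w},
      monoid.mult = foldr push,
      one = []\<rparr>"

lemma letter_inv_invol [simp]: "letter_inv (letter_inv a) = a"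
  and fst_letter_inv [simp]: "fst (letter_inv a) = fst a"
  and letter_inv_neq [simp]: "letter_inv a \<noteq> a"
  by (cases a; simp add: letter_inv_def)+

lemma reduced_simps [simp]:
  "reduced []"
  "reduced [a]"
  "reduced (a # b # w) \<longleftrightarrow> b \<noteq> letter_inv a \<and> reduced (b # w)"
  by (simp_all add: reduced_def)

lemma reduced_tl: "reduced (a # w) \<Longrightarrow> reduced w"
  by (cases w) auto

lemma reduced_push: "reduced w \<Longrightarrow> reduced (push a w)"
  by (cases w) (auto dest: reduced_tl)

lemma push_reduced: "reduced (a # w) \<Longrightarrow> push a w = a # w"
  by (cases w) auto

lemma push_push_inv: "reduced w \<Longrightarrow> push a (push (letter_inv a) w) = w"
  by (cases w) (auto simp: push_reduced)

lemma set_push: "set (push a w) \<subseteq> insert a (set w)"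
  by (cases w) auto

lemma reduced_foldr_push: "reduced v \<Longrightarrow> reduced (foldr push u v)"
  by (induction u) (auto simp: reduced_push)

lemma set_foldr_push: "set (foldr push u v) \<subseteq> set u \<union> set v"
proof (induction u)
  case (Cons a u)
  then show ?case using set_push[of a "foldr push u v"] by auto
qed simp

lemma foldr_push_push:
  assumes "reduced w"
  shows "foldr push (push a x) w = push a (foldr push x w)"
proof (cases x)
  case (Cons b x')
  have "push a (push (letter_inv a) (foldr push x' w)) = foldr push x' w"
    by (intro push_push_inv reduced_foldr_push assms)
  then show ?thesis using Cons by simp
qed simp

lemma foldr_push_assoc:
  "reduced w \<Longrightarrow> foldr push (foldr push u v) w = foldr push u (foldr push v w)"
  by (induction u) (simp_all add: foldr_push_push)

lemma foldr_push_Nil: "reduced u \<Longrightarrow> foldr push u [] = u"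
proof (induction u)
  case (Cons a u)
  then show ?case using reduced_tl[of a u] push_reduced[of a u] by simp
qed simp

lemma foldr_push_inv: "foldr push (rev (map letter_inv u)) u = []"
  by (induction u) simp_all

lemma reduced_inv: "reduced u \<Longrightarrow> reduced (rev (map letter_inv u))"
  unfolding reduced_def successively_rev successively_map
  by (erule successively_mono) auto

lemma group_free_group: "group (free_group S)"
proof (rule groupI)
  fix u v assume "u \<in> carrier (free_group S)" "v \<in> carrier (free_group S)"
  then show "u \<otimes>\<^bsub>free_group S\<^esub> v \<in> carrier (free_group S)"
    using set_foldr_push[of u v] by (fastforce simp: free_group_def reduced_foldr_push)
next
  fix u assume u: "u \<in> carrier (free_group S)"
  have "rev (map letter_inv u) \<in> carrier (free_group S)"
    using u by (auto simp: free_group_def reduced_inv image_image)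
  moreover have "rev (map letter_inv u) \<otimes>\<^bsub>free_group S\<^esub> u = \<one>\<^bsub>free_group S\<^esub>"
    by (simp add: free_group_def foldr_push_inv)
  ultimately show "\<exists>v\<in>carrier (free_group S). v \<otimes>\<^bsub>free_group S\<^esub> u = \<one>\<^bsub>free_group S\<^esub>"
    by blast
qed (auto simp: free_group_def foldr_push_assoc)

lemma (in group) free_group_universal:
  assumes f: "f \<in> S \<rightarrow> carrier G"
  shows "\<exists>h \<in> hom (free_group S) G. \<forall>x\<in>S. h [(x, True)] = f x"
proof -
  define val where "val a = (if snd a then f (fst a) else inv (f (fst a)))" for a :: "'c \<times> bool"
  define h where "h w = foldr (\<lambda>a g. val a \<otimes> g) w \<one>" for w
  have val_in: "val a \<in> carrier G" if "fst a \<in> S" for a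
    using that f by (auto simp: val_def)
  have val_inv: "val (letter_inv a) = inv (val a)" if "fst a \<in> S" for a
    using that f by (auto simp: val_def letter_inv_def Pi_iff)
  have h_in: "h w \<in> carrier G" if "fst ` set w \<subseteq> S" for w
    using that by (induction w) (auto simp: h_def val_in)
  have h_push: "h (push a w) = val a \<otimes> h w" if "fst ` set (a # w) \<subseteq> S" for a w
  proof (cases w)
    case (Cons b w')
    have "val a \<otimes> (inv (val a) \<otimes> h w') = h w'"
      using that Cons by (simp add: m_assoc [symmetric] val_in h_in)
    then show ?thesis using that Cons by (auto simp: h_def val_inv)
  qed (simp add: h_def)
  have "h (foldr push u v) = h u \<otimes> h v"
    if "fst ` set u \<subseteq> S" "fst ` set v \<subseteq> S" for u v
    using that
  proof (induction u)
    case Nil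
    then show ?case using h_in[of v] by (simp add: h_def)
  next
    case (Cons a u)
    have sub: "fst ` set (a # foldr push u v) \<subseteq> S"
      using Cons.prems set_foldr_push[of u v] by fastforce
    have "h (foldr push (a # u) v) = val a \<otimes> (h u \<otimes> h v)"
      using h_push[OF sub] Cons by simp
    also have "\<dots> = (val a \<otimes> h u) \<otimes> h v"
      using Cons.prems by (intro m_assoc [symmetric] val_in h_in) auto
    finally show ?case by (simp add: h_def)
  qed
  then have "h \<in> hom (free_group S) G"
    by (intro homI) (auto simp: free_group_def intro!: h_in)
  moreover have "h [(x, True)] = f x" if "x \<in> S" for x
    using that f by (auto simp: h_def val_def Pi_iff)
  ultimately show ?thesis by blast
qed

lemma free_group_generate:
  "generate (free_group S) ((\<lambda>x. [(x, True)]) ` S) = carrier (free_group S)"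
proof
  interpret F: group "free_group S" by (rule group_free_group)
  let ?B = "(\<lambda>x. [(x, True)]) ` S"
  have B: "?B \<subseteq> carrier (free_group S)" by (auto simp: free_group_def)
  then show "generate (free_group S) ?B \<subseteq> carrier (free_group S)"
    by (rule F.generate_incl)
  have letter: "[a] \<in> generate (free_group S) ?B" if a: "fst a \<in> S" for a
  proof (cases "snd a")
    case True
    then show ?thesis using a by (cases a) (auto intro: generate.incl)
  next
    case False
    have "[a] = inv\<^bsub>free_group S\<^esub> [(fst a, True)]"
      using a False
      by (intro F.inv_equality [symmetric]) (cases a; auto simp: free_group_def letter_inv_def)+
    then show ?thesis using a by (auto intro: generate.inv)
  qed
  show "carrier (free_group S) \<subseteq> generate (free_group S) ?B"
  proof
    fix w assume "w \<in> carrier (free_group S)"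
    then show "w \<in> generate (free_group S) ?B"
    proof (induction w)
      case Nil
      show ?case using generate.one[of "free_group S" ?B] by (simp add: free_group_def)
    next
      case (Cons a w)
      then have "w \<in> generate (free_group S) ?B" "fst a \<in> S"
        by (auto simp: free_group_def dest: reduced_tl)
      then have "[a] \<otimes>\<^bsub>free_group S\<^esub> w \<in> generate (free_group S) ?B"
        by (intro generate.eng letter)
      then show ?case using Cons.prems by (simp add: free_group_def push_reduced)
    qed
  qed
qed

text \<open>A basis of a free group \<open>G\<close> is a subset of \<open>G\<close>, so it is no restriction to let the
  index set \<open>S\<close> range over sets of elements of the type of \<open>G\<close>.\<close>

definition is_free_group :: "('a, 'b) monoid_scheme \<Rightarrow> bool" where
  "is_free_group G \<longleftrightarrow> group G \<and> (\<exists>S :: 'a set. G \<cong> free_group S)"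

definition finitely_generated_subgroup :: "'a set \<Rightarrow> ('a, 'b) monoid_scheme \<Rightarrow> bool" where
  "finitely_generated_subgroup H G \<longleftrightarrow>
     subgroup H G \<and> (\<exists>A. finite A \<and> A \<subseteq> carrier G \<and> generate G A = H)"

definition has_finite_index :: "'a set \<Rightarrow> ('a, 'b) monoid_scheme \<Rightarrow> bool" where
  "has_finite_index H G \<longleftrightarrow> finite (rcosets\<^bsub>G\<^esub> H)"

end

theory Submission
  imports Defs "HOL-Library.Sublist"
begin

text \<open>It suffices to find an epimorphism \<open>\<zeta>\<close> from \<open>G = \<langle>H, K\<rangle>\<close> to a free group of rank two whose kernel meets the
  product set \<open>HK\<close> trivially. By Nielsen--Schreier \<open>G\<close> is free on a finite set, which has at least two elements
  because nontrivial subgroups of an infinite cyclic group have finite index. The Stallings core graph of a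
  finitely generated subgroup of infinite index lacks an edge, and it can be completed to a finite permutation
  action. Applying to both completions a positive automorphism that turns a basis element \<open>a\<close> into a word crossing
  every edge of every orbit shows that, in a suitable basis, no conjugate of a power \<open>a\<^sup>m\<close>, \<open>m \<ge> 1\<close>, lies in \<open>H\<close> or
  \<open>K\<close>. By the pigeonhole principle the reduced words in \<open>H\<close> and \<open>K\<close> then contain only bounded powers of \<open>a\<close>, so those
  in \<open>HK\<close> contain no \<open>a\<^sup>L\<close> or \<open>a\<^sup>-\<^sup>L\<close> for some \<open>L\<close>. The map \<open>a \<mapsto> \<alpha>\<close>, \<open>x \<mapsto> \<alpha>\<^sup>q\<^sup>(\<^sup>x\<^sup>) \<beta> \<alpha>\<^sup>q\<^sup>(\<^sup>x\<^sup>)\<close> for the other basis elements \<open>x\<close>,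
  with distinct multiples \<open>q(x)\<close> of \<open>L\<close>, does not kill such a word.\<close>

subsection \<open>Reduced words\<close>

text \<open>The condition on the kernel yields all three demands: taking one factor trivial gives
  injectivity on \<open>H\<close> and on \<open>K\<close>, and a common value of \<open>h\<close>
  and \<open>k\<close> forces \<open>h = k\<close>, a point of the intersection. A completed core
  graph no longer describes \<open>H\<close> itself; what survives is that reduced words of
  \<open>H\<close> never traverse one particular edge. A word crossing every edge of its orbit from
  every starting point therefore stays outside \<open>H\<close>, and so do its conjugates, since
  conjugating only moves the starting point once enough copies of the word absorb the cancellation.
  Positive words make products and powers plain concatenations that can be followed as paths. The
  exponent \<open>q(x)\<close> stands on both sides of \<open>\<beta>\<close> because cancellation
  threatens both in \<open>x^-1 a^n y\<close> and in \<open>x a^n y^-1\<close>: in each case the two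
  \<open>\<beta>\<close> letters enclose \<open>\<alpha>\<close> to the power \<open>n\<close> plus
  or minus \<open>q(x) - q(y)\<close>, which for \<open>|n| < L\<close> vanishes only if
  \<open>n = 0\<close> and \<open>x = y\<close>.\<close>

definition winv :: "('a \<times> bool) list \<Rightarrow> ('a \<times> bool) list" where
  "winv w = rev (map letter_inv w)"

lemma winv_simps [simp]:
  "winv [] = []" "winv (a # w) = winv w @ [letter_inv a]" "winv (u @ v) = winv v @ winv u"
  "winv (winv w) = w" "length (winv w) = length w" "fst ` set (winv w) = fst ` set w"
  by (simp_all add: winv_def rev_map[symmetric] o_def image_image)

lemma winv_eq_Nil_iff [simp]: "winv w = [] \<longleftrightarrow> w = []"
  by (simp add: winv_def)

lemma reduced_winv [simp]: "reduced (winv w) \<longleftrightarrow> reduced w"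
  using reduced_inv[of w] reduced_inv[of "winv w"] by (fold winv_def) auto

lemma reduced_append_iff:
  "reduced (u @ v) \<longleftrightarrow>
     reduced u \<and> reduced v \<and> (u = [] \<or> v = [] \<or> hd v \<noteq> letter_inv (last u))"
  unfolding reduced_def by (rule successively_append_iff)

lemma reduced_Cons_iff: "reduced (a # w) \<longleftrightarrow> reduced w \<and> (w = [] \<or> hd w \<noteq> letter_inv a)"
  using reduced_append_iff[of "[a]" w] by simp

lemma foldr_push_reduced: "reduced (u @ v) \<Longrightarrow> foldr push u v = u @ v"
proof (induction u)
  case (Cons a u)
  then have "reduced (u @ v)" by (auto dest: reduced_tl)
  with Cons show ?case by (simp add: push_reduced)
qed simp

lemma foldr_push_winv_left: "foldr push (winv u) (u @ v) = v"
proof (induction u arbitrary: v)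
  case (Cons a u)
  have "push (letter_inv a) (a # u @ v) = u @ v" by simp
  then show ?case using Cons by (simp add: foldr_append)
qed simp

text \<open>Since \<open>u\<close> is reduced, cancellation happens only at the junction: a new
  letter \<open>a\<close> can cancel into \<open>v\<close> only when no letter of \<open>u\<close>
  survives behind it (\<open>u' = []\<close>), and then the cancelled block \<open>c\<close> grows
  by \<open>a\<close>.\<close>

lemma foldr_push_cancellation:
  assumes "reduced u"
  obtains u' c v' where "u = u' @ c" "v = winv c @ v'" "foldr push u v = u' @ v'"
proof -
  have "\<exists>u' c v'. u = u' @ c \<and> v = winv c @ v' \<and> foldr push u v = u' @ v'"
    using assms
  proof (induction u)
    case Nil
    show ?case by (intro exI[of _ "[]"] exI[of _ v]) simp
  next
    case (Cons a u)
    then obtain u' c v' where *: "u = u' @ c" "v = winv c @ v'" "foldr push u v = u' @ v'"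
      by (auto simp: reduced_Cons_iff)
    show ?case
    proof (cases "u' = [] \<and> v' \<noteq> [] \<and> hd v' = letter_inv a")
      case True
      then obtain v'' where "v' = letter_inv a # v''" by (cases v') auto
      then show ?thesis using * True
        by (intro exI[of _ "[]"] exI[of _ "a # c"] exI[of _ v'']) simp
    next
      case False
      have "push a (u' @ v') = a # u' @ v'"
        using False Cons.prems *(1) by (cases u'; cases v') (auto simp: reduced_Cons_iff)
      then show ?thesis using *
        by (intro exI[of _ "a # u'"] exI[of _ c] exI[of _ v']) simp
    qed
  qed
  then show thesis using that by blast
qed

text \<open>A prefix either ends inside the surviving part of \<open>u\<close> or contains it. In
  the second case the block cancelled from \<open>v\<close> is put back in front, so that coset
  arguments can pass from the product to its second factor.\<close>

lemma prefix_foldr_push: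
  assumes "reduced u" "reduced v" "prefix p (foldr push u v)"
  obtains "prefix p u" | q where "prefix q v" "p = foldr push u q"
proof -
  obtain u' c v' where *: "u = u' @ c" "v = winv c @ v'" "foldr push u v = u' @ v'"
    using foldr_push_cancellation assms(1) by blast
  have red: "reduced (u' @ v')" using *(3) reduced_foldr_push[OF assms(2), of u] by simp
  from assms(3) *(3) have "prefix p (u' @ v')" by simp
  then consider "prefix p u'" | q where "prefix q v'" "p = u' @ q"
    by (auto simp: prefix_append)
  then show thesis
  proof cases
    case 1
    then show thesis using * that(1) by (auto intro: prefix_order.trans)
  next
    case (2 q)
    then have "reduced (u' @ q)" using red by (auto simp: prefix_def reduced_append_iff)
    moreover have "foldr push c (winv c @ q) = q"
      using foldr_push_winv_left[of "winv c" q] by simp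
    ultimately have "p = foldr push u (winv c @ q)"
      using 2 * by (simp add: foldr_append foldr_push_reduced)
    then show thesis using that(2)[of "winv c @ q"] * 2 by simp
  qed
qed

lemma length_foldr_push: "length v \<le> length (foldr push u v) + length u"
proof (induction u)
  case (Cons a u)
  have "length w \<le> Suc (length (push a w))" for w by (cases w) auto
  from this[of "foldr push u v"] Cons show ?case by simp
qed simp

text \<open>Each letter of \<open>g\<close> removes at most one letter of \<open>u\<close>, so
  \<open>v\<close> is out of reach; this is how the middle of a long power survives
  conjugation.\<close>

lemma foldr_push_append_long:
  "length g \<le> length u \<Longrightarrow> foldr push g (u @ v) = foldr push g u @ v"
proof (induction g)
  case (Cons a g)
  have "foldr push g u \<noteq> []" using length_foldr_push[of u g] Cons.prems by auto
  then have "push a (foldr push g u @ v) = push a (foldr push g u) @ v"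
    by (cases "foldr push g u") auto
  then show ?case using Cons by simp
qed simp

lemma carrier_free_group: "w \<in> carrier (free_group S) \<longleftrightarrow> fst ` set w \<subseteq> S \<and> reduced w"
  and mult_free_group [simp]: "u \<otimes>\<^bsub>free_group S\<^esub> v = foldr push u v"
  and one_free_group [simp]: "\<one>\<^bsub>free_group S\<^esub> = []"
  by (simp_all add: free_group_def)

lemma inv_free_group: "w \<in> carrier (free_group S) \<Longrightarrow> inv\<^bsub>free_group S\<^esub> w = winv w"
  by (intro group.inv_equality[OF group_free_group])
     (auto simp: carrier_free_group foldr_push_inv winv_def image_image reduced_inv)

lemma winv_foldr_push:
  assumes "reduced u" "reduced v"
  shows "winv (foldr push u v) = foldr push (winv v) (winv u)"
proof -
  interpret group "free_group UNIV" by (rule group_free_group)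
  show ?thesis
    using inv_mult_group[of u v] assms m_closed[of u v]
    by (simp add: inv_free_group carrier_free_group)
qed

text \<open>The mirror image of \<open>foldr_push_append_long\<close>, obtained by inverting both
  sides.\<close>

lemma foldr_push_append_long_right:
  assumes "reduced (u @ y)" "reduced v" "length v \<le> length y"
  shows "foldr push (u @ y) v = u @ foldr push y v"
proof -
  have "winv (foldr push (u @ y) v) = foldr push (winv v) (winv y @ winv u)"
    using winv_foldr_push[OF assms(1,2)] by simp
  also have "\<dots> = foldr push (winv v) (winv y) @ winv u"
    using assms(3) by (intro foldr_push_append_long) simp
  also have "\<dots> = winv (u @ foldr push y v)"
    using assms winv_foldr_push[of y v] by (simp add: reduced_append_iff)
  finally show ?thesis using winv_simps(4) by metis
qed

lemma Nil_in_free_group [simp]: "[] \<in> carrier (free_group S)"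
  by (simp add: carrier_free_group)

lemma letter_in_free_group: "[a] \<in> carrier (free_group S) \<longleftrightarrow> fst a \<in> S"
  by (simp add: carrier_free_group)

lemma Cons_in_free_group:
  "a # w \<in> carrier (free_group S) \<longleftrightarrow>
     fst a \<in> S \<and> w \<in> carrier (free_group S) \<and> (w = [] \<or> hd w \<noteq> letter_inv a)"
  by (auto simp: carrier_free_group reduced_Cons_iff)

lemma append_in_free_groupD:
  "u @ v \<in> carrier (free_group S) \<Longrightarrow> u \<in> carrier (free_group S) \<and> v \<in> carrier (free_group S)"
  by (auto simp: carrier_free_group reduced_append_iff)

lemma hom_free_group_Cons:
  assumes "h \<in> hom (free_group S) G" "a # w \<in> carrier (free_group S)"
  shows "h (a # w) = h [a] \<otimes>\<^bsub>G\<^esub> h w"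
proof -
  have "push a w = a # w"
    using assms(2) by (simp add: carrier_free_group push_reduced)
  then show ?thesis
    using hom_mult[OF assms(1), of "[a]" w] assms(2)
    by (auto simp: Cons_in_free_group)
qed

lemma hom_free_group_winv:
  assumes "group G" "h \<in> hom (free_group S) G" "w \<in> carrier (free_group S)"
  shows "h (winv w) = inv\<^bsub>G\<^esub> h w"
proof -
  interpret group_hom "free_group S" G h
    using assms group_free_group by (simp add: group_hom_def group_hom_axioms_def)
  show ?thesis using hom_inv[OF assms(3)] by (simp add: inv_free_group assms(3))
qed

lemma hom_free_group_eqI:
  assumes "group G" "h \<in> hom (free_group S) G" "k \<in> hom (free_group S) G"
    and eq: "\<And>x. x \<in> S \<Longrightarrow> h [(x, True)] = k [(x, True)]"
    and "w \<in> carrier (free_group S)"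
  shows "h w = k w"
  using assms(5)
proof (induction w)
  case Nil
  show ?case
    using hom_one[OF assms(2) group_free_group assms(1)] hom_one[OF assms(3) group_free_group assms(1)]
    by simp
next
  case (Cons a w)
  have "h [a] = k [a]"
  proof (cases a)
    case (Pair x b)
    have x: "[(x, True)] \<in> carrier (free_group S)" "x \<in> S"
      using Cons.prems Pair by (simp_all add: Cons_in_free_group letter_in_free_group)
    show ?thesis
      using eq[OF x(2)] hom_free_group_winv[OF assms(1,2) x(1)] hom_free_group_winv[OF assms(1,3) x(1)] Pair
      by (cases b) (simp_all add: letter_inv_def)
  qed
  then show ?case
    using Cons hom_free_group_Cons[OF assms(2) Cons.prems] hom_free_group_Cons[OF assms(3) Cons.prems]
    by (auto simp: Cons_in_free_group)
qed

subsection \<open>The Nielsen--Schreier theorem\<close>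

lemma ex_wf_total: "\<exists>r :: 'a rel. wf r \<and> total r"
proof -
  obtain r :: "'a rel" where "Well_order r" "Field r = UNIV"
    using well_ordering by metis
  then have "wf (r - Id)" "total (r - Id)"
    unfolding well_order_on_def linear_order_on_def by simp_all
  then show ?thesis by blast
qed

text \<open>Any well-founded total order of the letters will do. Comparing lengths first makes the
  empty word least and makes a product with cancellation small, as the Schreier property
  requires.\<close>

definition shortlex :: "'a list rel" where
  "shortlex = lenlex (SOME r. wf r \<and> total r)"

lemma wf_shortlex: "wf shortlex" and total_shortlex: "total shortlex"
  using someI_ex[OF ex_wf_total] by (auto simp: shortlex_def intro: total_lenlex)

context group
begin

lemma schreier_telescope:
  assumes "t \<in> carrier G" "a \<in> carrier G" "s \<in> carrier G" "w \<in> carrier G" "r \<in> carrier G"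
  shows "(t \<otimes> a \<otimes> inv s) \<otimes> (s \<otimes> w \<otimes> inv r) = t \<otimes> (a \<otimes> w) \<otimes> inv r"
proof -
  have "inv s \<otimes> (s \<otimes> (w \<otimes> inv r)) = w \<otimes> inv r"
    using assms by (simp add: m_assoc[symmetric])
  then show ?thesis using assms by (simp add: m_assoc)
qed

end

locale schreier =
  fixes S :: "'a set" and G :: "('a \<times> bool) list set"
  assumes subgroup_G: "subgroup G (free_group S)"
begin

interpretation F: group "free_group S" by (rule group_free_group)

abbreviation W where "W \<equiv> carrier (free_group S)"
abbreviation step where "step t a \<equiv> foldr push t [a]"

lemma G_sub: "G \<subseteq> W" using subgroup_G by (rule subgroup.subset)

lemma step_in [simp]: "t \<in> W \<Longrightarrow> fst a \<in> S \<Longrightarrow> step t a \<in> W"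
  using F.m_closed[of t "[a]"] by (simp add: letter_in_free_group)

lemma mult_in [simp]: "t \<in> W \<Longrightarrow> w \<in> W \<Longrightarrow> foldr push t w \<in> W"
  using F.m_closed[of t w] by simp

lemma reduced_W [dest]: "w \<in> W \<Longrightarrow> reduced w"
  by (simp add: carrier_free_group)

definition rep :: "('a \<times> bool) list \<Rightarrow> ('a \<times> bool) list" where
  "rep w = (SOME t. t \<in> G #>\<^bsub>free_group S\<^esub> w \<and> (\<forall>s \<in> G #>\<^bsub>free_group S\<^esub> w. (s, t) \<notin> shortlex))"

lemma rep_props:
  assumes "w \<in> W"
  shows "rep w \<in> G #>\<^bsub>free_group S\<^esub> w" "s \<in> G #>\<^bsub>free_group S\<^esub> w \<Longrightarrow> (s, rep w) \<notin> shortlex"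
proof -
  have "w \<in> G #>\<^bsub>free_group S\<^esub> w" using F.rcos_self[OF assms subgroup_G] .
  then have "\<exists>t. t \<in> G #>\<^bsub>free_group S\<^esub> w \<and> (\<forall>s \<in> G #>\<^bsub>free_group S\<^esub> w. (s, t) \<notin> shortlex)"
    using wf_shortlex[unfolded wf_eq_minimal] by metis
  from someI_ex[OF this]
  show "rep w \<in> G #>\<^bsub>free_group S\<^esub> w" "s \<in> G #>\<^bsub>free_group S\<^esub> w \<Longrightarrow> (s, rep w) \<notin> shortlex"
    by (auto simp: rep_def)
qed

lemma rep_in [simp]: "w \<in> W \<Longrightarrow> rep w \<in> W"
  using rep_props(1) F.r_coset_subset_G[OF G_sub] by blast

lemma coset_rep: "w \<in> W \<Longrightarrow> G #>\<^bsub>free_group S\<^esub> rep w = G #>\<^bsub>free_group S\<^esub> w"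
  using F.repr_independence[OF rep_props(1) _ subgroup_G] by simp

lemma rep_cong: "G #>\<^bsub>free_group S\<^esub> v = G #>\<^bsub>free_group S\<^esub> w \<Longrightarrow> rep v = rep w"
  by (simp add: rep_def)

lemma rep_rep [simp]: "w \<in> W \<Longrightarrow> rep (rep w) = rep w"
  by (rule rep_cong) (rule coset_rep)

lemma coset_mult:
  "v \<in> W \<Longrightarrow> w \<in> W \<Longrightarrow> G #>\<^bsub>free_group S\<^esub> foldr push v w = (G #>\<^bsub>free_group S\<^esub> v) #>\<^bsub>free_group S\<^esub> w"
  using F.coset_mult_assoc[OF G_sub, of v w] by simp

lemma rep_mult [simp]:
  "v \<in> W \<Longrightarrow> w \<in> W \<Longrightarrow> rep (foldr push (rep v) w) = rep (foldr push v w)"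
  by (rule rep_cong) (simp add: coset_mult coset_rep)

lemma rep_unique:
  assumes "w \<in> W" "t \<in> G #>\<^bsub>free_group S\<^esub> w" "\<And>s. s \<in> G #>\<^bsub>free_group S\<^esub> w \<Longrightarrow> (s, t) \<notin> shortlex"
  shows "rep w = t"
  using rep_props[OF assms(1)] assms(2,3) total_shortlex by (auto simp: total_on_def)

lemma rep_G: "g \<in> G \<Longrightarrow> rep g = []"
proof (rule rep_unique)
  assume g: "g \<in> G"
  then show "g \<in> W" using G_sub by blast
  then show "[] \<in> G #>\<^bsub>free_group S\<^esub> g"
    using F.coset_join2[OF _ subgroup_G g] subgroup.one_closed[OF subgroup_G] by simp
qed (simp add: shortlex_def)

lemma rep_Nil [simp]: "rep [] = []"
  using rep_G[of "[]"] subgroup.one_closed[OF subgroup_G] by simp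

text \<open>The Schreier property. If \<open>t\<close> were not minimal, appending \<open>a\<close>
  to the smaller \<open>rep t\<close> would give a member of the coset of \<open>t @ [a]\<close>
  below \<open>t @ [a]\<close>: the order is stable under appending a letter, and if that letter
  cancels, the word is even shorter.\<close>

lemma rep_prefix_closed:
  assumes "t @ [a] \<in> W" "rep (t @ [a]) = t @ [a]"
  shows "rep t = t"
proof (rule ccontr)
  assume ne: "rep t \<noteq> t"
  have t: "t \<in> W" "[a] \<in> W" and ta: "step t a = t @ [a]"
    using assms(1) append_in_free_groupD foldr_push_reduced[OF reduced_W] by blast+
  have "t \<in> G #>\<^bsub>free_group S\<^esub> t" using F.rcos_self[OF t(1) subgroup_G] .
  then have lt: "(rep t, t) \<in> shortlex"
    using ne rep_props(2)[OF t(1)] total_shortlex by (auto simp: total_on_def)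
  have "G #>\<^bsub>free_group S\<^esub> step (rep t) a = G #>\<^bsub>free_group S\<^esub> (t @ [a])"
    using t by (simp add: coset_mult coset_rep flip: ta)
  moreover have "step (rep t) a \<in> G #>\<^bsub>free_group S\<^esub> step (rep t) a"
    using t by (intro F.rcos_self subgroup_G) simp
  ultimately have not_lt: "(step (rep t) a, t @ [a]) \<notin> shortlex"
    using rep_props(2)[OF assms(1)] assms(2) by simp
  show False
  proof (cases "reduced (rep t @ [a])")
    case True
    then show ?thesis
      using not_lt lt lenlex_append1[of "rep t" t _ "[a]" "[a]"]
      by (simp add: foldr_push_reduced shortlex_def)
  next
    case False
    have red: "reduced (rep t)" using rep_in[OF t(1)] by (rule reduced_W)
    obtain u' c v' where c: "rep t = u' @ c" "[a] = winv c @ v'" "step (rep t) a = u' @ v'"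
      using foldr_push_cancellation[OF red, where v = "[a]"] by blast
    have "c \<noteq> []" using False c reduced_foldr_push[of "[a]" "rep t"] by auto
    then have "v' = []" using c(2) by (cases c rule: rev_cases) auto
    moreover have "length (rep t) \<le> length t"
      using lt lenlex_length by (auto simp: shortlex_def)
    ultimately have "length (step (rep t) a) < length (t @ [a])"
      using c(1,3) by simp
    then show ?thesis using not_lt by (auto simp: shortlex_def lenlex_conv)
  qed
qed

text \<open>\<open>rep\<close> selects a Schreier transversal. The letter \<open>tau t a\<close> encodes the Schreier generator \<open>t a (rep (t a))\<^sup>-\<^sup>1\<close>,
  or the inverse of one if \<open>a\<close> is a formal inverse, and \<open>sigma\<close> is the cocycle extending \<open>tau\<close> to words; on \<open>G\<close> it is
  the rewriting homomorphism.\<close>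

definition basis :: "(('a \<times> bool) list \<times> 'a) set" where
  "basis = {(t, x). t \<in> W \<and> rep t = t \<and> x \<in> S \<and> rep (step t (x, True)) \<noteq> step t (x, True)}"

definition tau :: "('a \<times> bool) list \<Rightarrow> 'a \<times> bool \<Rightarrow> ((('a \<times> bool) list \<times> 'a) \<times> bool) list" where
  "tau t a = (if rep (step t a) = step t a then []
     else [((if snd a then t else rep (step t a), fst a), snd a)])"

fun sigma where
  "sigma t [] = []"
| "sigma t (a # w) = foldr push (tau t a) (sigma (rep (step t a)) w)"

section \<open>The rewriting cocycle\<close>

lemma step_step_inv:
  assumes "t \<in> W" "fst a \<in> S"
  shows "step (step t a) (letter_inv a) = t"
  using foldr_push_assoc[of "[letter_inv a]" t "[a]"] assms
  by (simp add: foldr_push_Nil reduced_W)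

lemma rep_step_back:
  assumes "t \<in> W" "rep t = t" "fst a \<in> S"
  shows "rep (step (rep (step t a)) (letter_inv a)) = t"
  using assms by (simp add: step_step_inv letter_in_free_group)

text \<open>An edge lies in the spanning tree in one direction exactly when it does in the other, so
  traversing it backwards contributes the inverse letter. This makes \<open>sigma\<close> compatible
  with free reduction.\<close>

lemma tau_back:
  assumes "t \<in> W" "rep t = t" "fst a \<in> S"
  shows "tau (rep (step t a)) (letter_inv a) = winv (tau t a)"
proof -
  let ?s = "rep (step t a)"
  have "rep (step ?s (letter_inv a)) = step ?s (letter_inv a) \<longleftrightarrow> ?s = step t a"
  proof
    assume "rep (step ?s (letter_inv a)) = step ?s (letter_inv a)"
    then have "step ?s (letter_inv a) = t" using rep_step_back[OF assms] by simp
    then show "?s = step t a" using step_step_inv[of ?s "letter_inv a"] assms by simp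
  qed (use assms step_step_inv in simp)
  then show ?thesis
    using rep_step_back[OF assms] by (cases a) (auto simp: tau_def letter_inv_def)
qed

lemma tau_in:
  assumes "t \<in> W" "rep t = t" "fst a \<in> S"
  shows "tau t a \<in> carrier (free_group basis)"
proof (cases "snd a")
  case True
  then show ?thesis using assms by (cases a) (auto simp: tau_def basis_def carrier_free_group)
next
  case False
  then have a: "letter_inv a = (fst a, True)" by (simp add: letter_inv_def)
  have "tau (rep (step t a)) (letter_inv a) \<in> carrier (free_group basis)"
    unfolding a tau_def using assms by (simp add: letter_in_free_group[where S = basis]) (simp add: basis_def)
  then show ?thesis unfolding tau_back[OF assms] carrier_free_group by simp
qed

lemma sigma_in:
  assumes "t \<in> W" "rep t = t" "w \<in> W"
  shows "sigma t w \<in> carrier (free_group basis)"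
  using assms
proof (induction w arbitrary: t)
  case (Cons a w)
  then have "tau t a \<in> carrier (free_group basis)"
    "sigma (rep (step t a)) w \<in> carrier (free_group basis)"
    by (auto simp: Cons_in_free_group intro!: tau_in Cons.IH)
  then show ?case using group.is_monoid[OF group_free_group, THEN monoid.m_closed] by fastforce
qed simp

lemma sigma_push:
  assumes "t \<in> W" "rep t = t" "w \<in> W" "fst a \<in> S"
  shows "sigma t (push a w) = foldr push (tau t a) (sigma (rep (step t a)) w)"
proof (cases "w \<noteq> [] \<and> hd w = letter_inv a")
  case True
  then obtain w' where w: "w = letter_inv a # w'" by (cases w) auto
  have red: "reduced (sigma t w')"
    using sigma_in[OF assms(1,2), of w'] assms(3) w
    by (simp add: Cons_in_free_group carrier_free_group[of "sigma _ _"])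
  have "foldr push (tau t a) (foldr push (winv (tau t a)) (sigma t w')) = sigma t w'"
    by (simp add: tau_def push_push_inv red)
  then show ?thesis using w assms by (simp add: tau_back step_step_inv letter_in_free_group)
next
  case False
  then have "push a w = a # w" by (cases w) auto
  then show ?thesis by simp
qed

text \<open>The cocycle identity: the second factor is rewritten from the representative reached
  after \<open>u\<close>. For elements of \<open>G\<close> that representative is empty, so
  \<open>sigma []\<close> is multiplicative there.\<close>

lemma sigma_mult:
  assumes "t \<in> W" "rep t = t" "u \<in> W" "v \<in> W"
  shows "sigma t (foldr push u v) = foldr push (sigma t u) (sigma (rep (foldr push t u)) v)"
  using assms
proof (induction u arbitrary: t)
  case Nil
  then show ?case by (simp add: foldr_push_Nil reduced_W)
next
  case (Cons a u)
  have a: "fst a \<in> S" "u \<in> W" using Cons.prems by (auto simp: Cons_in_free_group)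
  let ?s = "rep (step t a)"
  have tu: "foldr push (step t a) u = foldr push t (a # u)"
    using foldr_push_assoc[of u t "[a]"] Cons.prems a by (simp add: reduced_W push_reduced)
  have red: "reduced (sigma (rep (foldr push t (a # u))) v)"
    using sigma_in[of "rep (foldr push t (a # u))" v] mult_in[OF Cons.prems(1,3)] Cons.prems(4)
    by (simp add: carrier_free_group[of "sigma _ _"])
  show ?case
    using Cons a sigma_push[of t "foldr push u v" a] foldr_push_assoc[OF red, of "tau t a" "sigma ?s u"] tu
    by simp
qed

text \<open>By the Schreier property every prefix of a representative is a representative, so the
  word runs along tree edges only.\<close>

lemma sigma_rep: "t \<in> W \<Longrightarrow> rep t = t \<Longrightarrow> sigma [] t = []"
proof (induction t rule: rev_induct)
  case (snoc a t)
  have t: "t \<in> W" "[a] \<in> W" "step t a = t @ [a]"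
    using snoc.prems(1) append_in_free_groupD foldr_push_reduced[OF reduced_W] by blast+
  have rep_t: "rep t = t" using rep_prefix_closed snoc.prems by blast
  have "sigma [] (t @ [a]) = foldr push (sigma [] t) (sigma (rep t) [a])"
    using sigma_mult[of "[]" t "[a]"] t by (simp add: foldr_push_Nil reduced_W)
  then show ?case
    using snoc.IH t rep_t snoc.prems by (simp add: tau_def)
qed simp

lemma sigma_hom: "sigma [] \<in> hom ((free_group S)\<lparr>carrier := G\<rparr>) (free_group basis)"
proof (rule homI)
  fix g assume "g \<in> carrier ((free_group S)\<lparr>carrier := G\<rparr>)"
  then show "sigma [] g \<in> carrier (free_group basis)"
    using G_sub by (intro sigma_in) auto
next
  fix g h assume "g \<in> carrier ((free_group S)\<lparr>carrier := G\<rparr>)" "h \<in> carrier ((free_group S)\<lparr>carrier := G\<rparr>)"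
  then have gh: "g \<in> G" "g \<in> W" "h \<in> W" using G_sub by auto
  show "sigma [] (g \<otimes>\<^bsub>(free_group S)\<lparr>carrier := G\<rparr>\<^esub> h) = sigma [] g \<otimes>\<^bsub>free_group basis\<^esub> sigma [] h"
    using sigma_mult[of "[]" g h] gh by (simp add: rep_G)
qed

section \<open>Inverting the rewriting map\<close>

definition schreier_generator :: "('a \<times> bool) list \<Rightarrow> 'a \<Rightarrow> ('a \<times> bool) list" where
  "schreier_generator t x = foldr push (step t (x, True)) (winv (rep (step t (x, True))))"

lemma winv_in: "w \<in> W \<Longrightarrow> winv w \<in> W"
  by (simp add: carrier_free_group)

lemma mult_winv_rep_in_G:
  assumes "w \<in> W"
  shows "foldr push w (winv (rep w)) \<in> G"
proof -
  have "G #>\<^bsub>free_group S\<^esub> (w \<otimes>\<^bsub>free_group S\<^esub> inv\<^bsub>free_group S\<^esub> (rep w)) = G"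
    using assms by (intro F.coset_mult_inv2 G_sub) (simp_all add: coset_rep)
  then have "w \<otimes>\<^bsub>free_group S\<^esub> inv\<^bsub>free_group S\<^esub> (rep w) \<in> G"
    using assms by (intro F.coset_join1[OF _ _ subgroup_G] F.m_closed F.inv_closed rep_in)
  then show ?thesis using assms by (simp add: inv_free_group)
qed

text \<open>Only the middle edge, labelled \<open>x\<close>, leaves the tree. The way back
  contributes nothing, because a representative followed by its inverse reduces to the empty word
  and the representative itself is rewritten to the empty word.\<close>

lemma sigma_schreier_generator:
  assumes "(t, x) \<in> basis"
  shows "sigma [] (schreier_generator t x) = [((t, x), True)]"
proof -
  let ?a = "(x, True)" let ?s = "rep (step t ?a)"
  have t: "t \<in> W" "rep t = t" "x \<in> S" "?s \<noteq> step t ?a"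
    using assms by (auto simp: basis_def)
  have s: "?s \<in> W" "winv ?s \<in> W" using t by (simp_all add: winv_in)
  have "sigma [] (foldr push ?s (winv ?s)) = foldr push (sigma [] ?s) (sigma ?s (winv ?s))"
    using sigma_mult[of "[]" ?s "winv ?s"] s t by (simp add: foldr_push_Nil reduced_W)
  moreover have "foldr push ?s (winv ?s) = []"
    using foldr_push_winv_left[of "winv ?s" "[]"] by simp
  ultimately have 1: "sigma ?s (winv ?s) = []"
    using sigma_rep[of ?s] t by simp
  have st: "step t ?a \<in> W" using t by simp
  have "sigma [] (schreier_generator t x) = foldr push (sigma [] (step t ?a)) (sigma ?s (winv ?s))"
    unfolding schreier_generator_def
    using sigma_mult[of "[]" "step t ?a" "winv ?s"] s st by (simp add: foldr_push_Nil reduced_W del: foldr.simps(2))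
  also have "\<dots> = sigma [] (step t ?a)"
    unfolding 1 using sigma_in[of "[]" "step t ?a"] st
    by (simp add: foldr_push_Nil carrier_free_group[of "sigma _ _"] del: foldr.simps(2))
  also have "\<dots> = foldr push (sigma [] t) (sigma t [?a])"
    using sigma_mult[of "[]" t "[?a]"] t by (simp add: foldr_push_Nil reduced_W letter_in_free_group)
  also have "\<dots> = [((t, x), True)]"
    using sigma_rep[of t] t by (simp add: tau_def)
  finally show ?thesis .
qed

text \<open>\<open>psi\<close> turns \<open>tau t a\<close> into \<open>t a (rep (t a))^-1\<close>,
  and these factors telescope. With \<open>t = []\<close> and \<open>w\<close> in \<open>G\<close>
  both outer representatives are empty, so \<open>w\<close> is recovered.\<close>

lemma sigma_left_inverse:
  assumes psi: "psi \<in> hom (free_group basis) (free_group S)"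
    and gen: "\<And>t x. (t, x) \<in> basis \<Longrightarrow> psi [((t, x), True)] = schreier_generator t x"
    and "t \<in> W" "rep t = t" "w \<in> W"
  shows "psi (sigma t w) = foldr push (foldr push t w) (winv (rep (foldr push t w)))"
  using assms(3-5)
proof (induction w arbitrary: t)
  case Nil
  have "foldr push t (winv t) = []" using foldr_push_winv_left[of "winv t" "[]"] by simp
  moreover have "psi [] = []"
    using hom_one[OF psi group_free_group group_free_group] by simp
  ultimately show ?case using Nil by (simp add: foldr_push_Nil reduced_W)
next
  case (Cons a w)
  have a: "fst a \<in> S" "w \<in> W" "[a] \<in> W" using Cons.prems by (auto simp: Cons_in_free_group)
  let ?s = "rep (step t a)"
  have s: "?s \<in> W" using Cons.prems a by simp
  have psi_tau: "psi (tau t a) = foldr push (step t a) (winv ?s)"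
  proof (cases "?s = step t a")
    case True
    then have "psi (tau t a) = []"
      using hom_one[OF psi group_free_group group_free_group] by (simp add: tau_def)
    then show ?thesis
      using True foldr_push_winv_left[of "winv (step t a)" "[]"] by simp
  next
    case nontriv: False
    show ?thesis
    proof (cases "snd a")
      case True
      then have "a = (fst a, True)" by (simp add: prod_eq_iff)
      then show ?thesis
        using nontriv Cons.prems a gen[of t "fst a"] True
        by (simp add: tau_def schreier_generator_def basis_def)
    next
      case False
      then have a': "letter_inv a = (fst a, True)" by (simp add: letter_inv_def)
      have rep_s: "rep (step ?s (letter_inv a)) = t" by (rule rep_step_back) (use Cons.prems a in auto)
      have ne: "step ?s (letter_inv a) \<noteq> t"
        using nontriv step_step_inv[of ?s "letter_inv a"] s a by auto
      have b: "(?s, fst a) \<in> basis"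
        using s a Cons.prems rep_s ne by (simp add: basis_def a')
      have "tau t a = winv [((?s, fst a), True)]"
        using nontriv False by (simp add: tau_def letter_inv_def)
      then have "psi (tau t a) = winv (schreier_generator ?s (fst a))"
        using hom_free_group_winv[OF group_free_group psi, of "[((?s, fst a), True)]"] b gen[OF b]
        by (simp add: letter_in_free_group inv_free_group schreier_generator_def s winv_in a)
      also have "\<dots> = winv (foldr push (step ?s (letter_inv a)) (winv t))"
        unfolding schreier_generator_def using rep_s by (simp add: a')
      also have "\<dots> = foldr push t (winv (step ?s (letter_inv a)))"
        using winv_foldr_push[of "step ?s (letter_inv a)" "winv t"] step_in[of ?s "letter_inv a"] s a Cons.prems
        by (simp add: reduced_W del: foldr.simps(2))
      also have "winv (step ?s (letter_inv a)) = foldr push [a] (winv ?s)"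
        using winv_foldr_push[of ?s "[letter_inv a]"] s by (simp add: reduced_W)
      also have "foldr push t (foldr push [a] (winv ?s)) = foldr push (step t a) (winv ?s)"
        using foldr_push_assoc[of "winv ?s" t "[a]"] s by (simp add: reduced_W)
      finally show ?thesis .
    qed
  qed
  have rs: "rep ?s = ?s" using Cons.prems a by simp
  have aw: "foldr push t (a # w) = foldr push (step t a) w"
    using foldr_push_assoc[of w t "[a]"] Cons.prems by (simp add: reduced_W push_reduced Cons_in_free_group)
  have "psi (sigma t (a # w)) = foldr push (psi (tau t a)) (psi (sigma ?s w))"
    using hom_mult[OF psi tau_in[of t a] sigma_in[OF s rs a(2)]] Cons.prems a by simp
  also have "\<dots> = foldr push (foldr push (step t a) (winv ?s))
      (foldr push (foldr push ?s w) (winv (rep (foldr push ?s w))))"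
    unfolding psi_tau using Cons.IH[OF s rs a(2)] by simp
  also have "rep (foldr push ?s w) = rep (foldr push t (a # w))"
    unfolding aw using Cons.prems a by simp
  also have "foldr push (foldr push (step t a) (winv ?s))
      (foldr push (foldr push ?s w) (winv (rep (foldr push t (a # w))))) =
    foldr push (foldr push t (a # w)) (winv (rep (foldr push t (a # w))))"
    using F.schreier_telescope[of t "[a]" ?s w "rep (foldr push t (a # w))"]
      Cons.prems a s mult_in[OF Cons.prems(1,3)]
    by (simp add: inv_free_group del: foldr.simps(2))
       (simp add: push_reduced reduced_W)
  finally show ?case .
qed

lemma sigma_iso: "sigma [] \<in> iso ((free_group S)\<lparr>carrier := G\<rparr>) (free_group basis)"
proof (rule isoI[OF sigma_hom])
  have "(\<lambda>(t, x). schreier_generator t x) \<in> basis \<rightarrow> carrier (free_group S)"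
    using mult_winv_rep_in_G G_sub by (auto simp: schreier_generator_def basis_def)
  from F.free_group_universal[OF this] obtain psi where
    psi: "psi \<in> hom (free_group basis) (free_group S)"
    and gen: "\<And>t x. (t, x) \<in> basis \<Longrightarrow> psi [((t, x), True)] = schreier_generator t x"
    by fastforce
  have left: "psi (sigma [] g) = g" if "g \<in> G" for g
    using sigma_left_inverse[OF psi gen, of "[]" g] that G_sub
    by (auto simp: foldr_push_Nil reduced_W rep_G)
  interpret G: group "(free_group S)\<lparr>carrier := G\<rparr>"
    using F.subgroup_imp_group[OF subgroup_G] .
  interpret sigma: group_hom "(free_group S)\<lparr>carrier := G\<rparr>" "free_group basis" "sigma []"
    using sigma_hom group_free_group by (auto simp: group_hom_def group_hom_axioms_def intro: G.is_group)
  have "carrier (free_group basis) \<subseteq> sigma [] ` G"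
    unfolding free_group_generate[symmetric]
  proof (rule group.generate_subgroup_incl[OF group_free_group])
    show "(\<lambda>b. [(b, True)]) ` basis \<subseteq> sigma [] ` G"
    proof clarify
      fix t x assume b: "(t, x) \<in> basis"
      then have "schreier_generator t x \<in> G"
        unfolding schreier_generator_def by (intro mult_winv_rep_in_G) (simp add: basis_def)
      then show "[((t, x), True)] \<in> sigma [] ` G"
        by (intro image_eqI[of _ _ "schreier_generator t x"]) (simp_all add: sigma_schreier_generator b)
    qed
    show "subgroup (sigma [] ` G) (free_group basis)"
      using sigma.img_is_subgroup by simp
  qed
  moreover have "sigma [] ` G \<subseteq> carrier (free_group basis)"
    using sigma_in[of "[]"] G_sub by auto
  ultimately show "bij_betw (sigma []) (carrier ((free_group S)\<lparr>carrier := G\<rparr>)) (carrier (free_group basis))"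
    by (auto simp: bij_betw_def intro!: inj_on_inverseI[of _ psi] left)
qed

end

theorem nielsen_schreier:
  fixes S :: "'a set"
  assumes "subgroup G (free_group S)"
  shows "\<exists>B :: (('a \<times> bool) list \<times> 'a) set. (free_group S)\<lparr>carrier := G\<rparr> \<cong> free_group B"
proof -
  interpret schreier S G using assms by (rule schreier.intro)
  show ?thesis using is_isoI[OF sigma_iso] by (rule exI)
qed

text \<open>The words in the finitely many letters that occur in \<open>A\<close> form a subgroup
  containing \<open>A\<close>, hence everything; so every one-letter word uses only those
  letters.\<close>

lemma finite_basis_if_finitely_generated:
  assumes "finite A" "A \<subseteq> carrier (free_group B)" "generate (free_group B) A = carrier (free_group B)"
  shows "finite B"
proof -
  let ?C = "\<Union>w\<in>A. fst ` set w"
  interpret group "free_group B" by (rule group_free_group)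
  have "subgroup {w \<in> carrier (free_group B). fst ` set w \<subseteq> ?C} (free_group B)"
  proof (rule subgroupI)
    have "[] \<in> {w \<in> carrier (free_group B). fst ` set w \<subseteq> ?C}" by simp
    then show "{w \<in> carrier (free_group B). fst ` set w \<subseteq> ?C} \<noteq> {}" by blast
  next
    fix u v assume "u \<in> {w \<in> carrier (free_group B). fst ` set w \<subseteq> ?C}"
      "v \<in> {w \<in> carrier (free_group B). fst ` set w \<subseteq> ?C}"
    then show "u \<otimes>\<^bsub>free_group B\<^esub> v \<in> {w \<in> carrier (free_group B). fst ` set w \<subseteq> ?C}"
      using m_closed[of u v] set_foldr_push[of u v] by (simp del: UN_simps) blast
  next
    fix w assume w: "w \<in> {w \<in> carrier (free_group B). fst ` set w \<subseteq> ?C}"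
    then have "inv\<^bsub>free_group B\<^esub> w = winv w" by (intro inv_free_group) blast
    moreover have "w \<in> carrier (free_group B)" "fst ` set w \<subseteq> ?C" using w by blast+
    ultimately show "inv\<^bsub>free_group B\<^esub> w \<in> {w \<in> carrier (free_group B). fst ` set w \<subseteq> ?C}"
      by (simp add: carrier_free_group del: UN_simps image_subset_iff)
  qed blast
  moreover have "A \<subseteq> {w \<in> carrier (free_group B). fst ` set w \<subseteq> ?C}"
    using assms(2) by blast
  ultimately have "carrier (free_group B) \<subseteq> {w \<in> carrier (free_group B). fst ` set w \<subseteq> ?C}"
    unfolding assms(3)[symmetric] by (intro generate_subgroup_incl)
  moreover have "[(x, True)] \<in> carrier (free_group B)" if "x \<in> B" for x
    using that by (simp add: letter_in_free_group)
  ultimately have "B \<subseteq> ?C" by fastforce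
  then show ?thesis by (rule finite_subset) (use assms(1) in auto)
qed

subsection \<open>Finitely generated subgroups of infinite index\<close>

definition letter_act :: "('a \<Rightarrow> 'v \<Rightarrow> 'v) \<Rightarrow> 'a \<times> bool \<Rightarrow> 'v \<Rightarrow> 'v" where
  "letter_act \<pi> a = (if snd a then \<pi> (fst a) else inv_into UNIV (\<pi> (fst a)))"

text \<open>Words are read from left to right, as a right action, to match right cosets: the vertex
  reached from \<open>H\<close> along \<open>p\<close> is meant to be \<open>H p\<close>.\<close>

definition run :: "('a \<Rightarrow> 'v \<Rightarrow> 'v) \<Rightarrow> ('a \<times> bool) list \<Rightarrow> 'v \<Rightarrow> 'v" where
  "run \<pi> w v = fold (letter_act \<pi>) w v"

lemma run_simps [simp]:
  "run \<pi> [] v = v" "run \<pi> (a # w) v = run \<pi> w (letter_act \<pi> a v)"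
  "run \<pi> (u @ w) v = run \<pi> w (run \<pi> u v)"
  by (simp_all add: run_def)

lemma letter_act_inv:
  assumes "\<And>x. \<pi> x permutes Y"
  shows "letter_act \<pi> (letter_inv a) (letter_act \<pi> a v) = v"
  using permutes_inverses[OF assms] by (simp add: letter_act_def letter_inv_def)

lemma run_winv:
  assumes "\<And>x. \<pi> x permutes Y"
  shows "run \<pi> (winv w) (run \<pi> w v) = v"
  by (induction w arbitrary: v) (simp_all add: letter_act_inv[OF assms])

lemma run_in:
  assumes "\<And>x. \<pi> x permutes Y"
  shows "run \<pi> w v \<in> Y \<longleftrightarrow> v \<in> Y"
  by (induction w arbitrary: v)
     (simp_all add: letter_act_def permutes_in_image[OF assms] permutes_in_image[OF permutes_inv[OF assms]])

lemma extend_injection_to_permutation: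
  assumes "finite V" "E \<subseteq> V" "inj_on f E" "f ` E \<subseteq> V"
  shows "\<exists>p. p permutes V \<and> (\<forall>v\<in>E. p v = f v)"
proof -
  have "card (V - E) = card (V - f ` E)"
    using assms by (simp add: card_Diff_subset finite_subset card_image)
  then obtain g where g: "bij_betw g (V - E) (V - f ` E)"
    using assms(1) by (metis finite_Diff finite_same_card_bij)
  define p where "p v = (if v \<in> E then f v else if v \<in> V then g v else v)" for v
  have "bij_betw p E (f ` E)"
    using bij_betw_imageI[OF assms(3) refl] by (rule bij_betw_cong[THEN iffD1, rotated]) (simp add: p_def)
  moreover have "bij_betw p (V - E) (V - f ` E)"
    using g by (rule bij_betw_cong[THEN iffD1, rotated]) (simp add: p_def)
  ultimately have "bij_betw p (E \<union> (V - E)) (f ` E \<union> (V - f ` E))"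
    by (rule bij_betw_combine) blast
  moreover have "E \<union> (V - E) = V" "f ` E \<union> (V - f ` E) = V" using assms(2,4) by blast+
  ultimately have "p permutes V"
    using assms(2) by (intro bij_imp_permutes) (auto simp: p_def)
  then show ?thesis by (auto simp: p_def)
qed

text \<open>The vertices of the Stallings core graph, seen inside the graph of right cosets: those
  visited by the loops at \<open>H\<close> that the reduced words of \<open>H\<close> read.\<close>

definition prefix_cosets :: "'a set \<Rightarrow> ('a \<times> bool) list set \<Rightarrow> ('a \<times> bool) list set set" where
  "prefix_cosets S H = {H #>\<^bsub>free_group S\<^esub> p | p. \<exists>h\<in>H. prefix p h}"

text \<open>Prefixes of generators and of their inverses suffice: a prefix of \<open>h1 h2\<close>
  is a prefix of \<open>h1\<close>, or has the form \<open>h1 q\<close> with \<open>q\<close> a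
  prefix of \<open>h2\<close>, and then \<open>H h1 q = H q\<close>.\<close>

lemma finite_prefix_cosets:
  assumes "finitely_generated_subgroup H (free_group S)"
  shows "finite (prefix_cosets S H)"
proof -
  interpret group "free_group S" by (rule group_free_group)
  obtain A where H: "subgroup H (free_group S)"
    and A: "finite A" "A \<subseteq> carrier (free_group S)" "generate (free_group S) A = H"
    using assms by (auto simp: finitely_generated_subgroup_def)
  define Q where "Q = insert [] (\<Union>w \<in> A \<union> winv ` A. set (prefixes w))"
  let ?c = "\<lambda>p. H #>\<^bsub>free_group S\<^esub> p"
  have "\<forall>p. prefix p h \<longrightarrow> ?c p \<in> ?c ` Q" if "h \<in> generate (free_group S) A" for h
    using that
  proof (induction h rule: generate.induct)
    case one
    then show ?case by (auto simp: Q_def)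
  next
    case (incl h)
    then show ?case by (fastforce simp: Q_def)
  next
    case (inv h)
    then have "inv\<^bsub>free_group S\<^esub> h = winv h" using A(2) by (intro inv_free_group) blast
    then show ?case using inv by (fastforce simp: Q_def)
  next
    case (eng h1 h2)
    then have h: "h1 \<in> H" "h2 \<in> H" "h1 \<in> carrier (free_group S)" "h2 \<in> carrier (free_group S)"
      using A(3) subgroup.subset[OF H] by blast+
    show ?case
    proof (intro allI impI)
      fix p assume "prefix p (h1 \<otimes>\<^bsub>free_group S\<^esub> h2)"
      then have "prefix p (foldr push h1 h2)" by simp
      moreover have "reduced h1" "reduced h2" using h by (simp_all add: carrier_free_group)
      ultimately consider "prefix p h1" | q where "prefix q h2" "p = foldr push h1 q"
        using prefix_foldr_push by blast
      then show "?c p \<in> ?c ` Q"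
      proof cases
        case 1
        then show ?thesis using eng by blast
      next
        case (2 q)
        then have q: "q \<in> carrier (free_group S)"
          using h(4) append_in_free_groupD by (auto simp: prefix_def)
        have "?c p = (H #>\<^bsub>free_group S\<^esub> h1) #>\<^bsub>free_group S\<^esub> q"
          using coset_mult_assoc[OF subgroup.subset[OF H] h(3) q] 2 by simp
        also have "\<dots> = ?c q" using coset_join2[OF h(3) H h(1)] by simp
        finally show ?thesis using 2 eng by simp
      qed
    qed
  qed
  then have "prefix_cosets S H \<subseteq> ?c ` Q" using A(3) by (auto simp: prefix_cosets_def)
  moreover have "finite Q" using A(1) by (simp add: Q_def)
  ultimately show ?thesis by (meson finite_surj)
qed

text \<open>The finite set \<open>Y\<close> with its action is a completion of the Stallings core graph of \<open>H\<close>;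
  the edge leaving \<open>run \<pi> p0 base\<close> with label \<open>x0\<close> is not part of the core.\<close>

lemma finite_completion_with_missing_edge:
  assumes fg: "finitely_generated_subgroup H (free_group S)"
    and inf: "\<not> has_finite_index H (free_group S)"
  shows "\<exists>(Y :: ('a \<times> bool) list set set) \<pi> base x0 p0.
    finite Y \<and> (\<forall>x :: 'a. \<pi> x permutes Y) \<and> base \<in> Y \<and> x0 \<in> S \<and> p0 \<in> carrier (free_group S) \<and>
    (\<forall>p q. p @ (x0, True) # q \<in> H \<longrightarrow> run \<pi> p base \<noteq> run \<pi> p0 base)"
proof -
  interpret group "free_group S" by (rule group_free_group)
  have H: "subgroup H (free_group S)" using fg by (simp add: finitely_generated_subgroup_def)
  note H_sub = subgroup.subset[OF H]
  let ?V = "prefix_cosets S H"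
  let ?c = "\<lambda>p. H #>\<^bsub>free_group S\<^esub> p"
  let ?step = "\<lambda>v a. v #>\<^bsub>free_group S\<^esub> [a]"
  have fin: "finite ?V" by (rule finite_prefix_cosets[OF fg])
  have base: "?c [] = H" using coset_mult_one[OF H_sub] by simp
  have base_in: "H \<in> ?V"
    using base subgroup.one_closed[OF H] unfolding prefix_cosets_def by fastforce
  have V_E: "\<exists>p. p \<in> carrier (free_group S) \<and> v = ?c p" if "v \<in> ?V" for v
    using that H_sub append_in_free_groupD by (fastforce simp: prefix_cosets_def prefix_def)
  have V_sub: "v \<subseteq> carrier (free_group S)" if "v \<in> ?V" for v
    using V_E[OF that] r_coset_subset_G[OF H_sub] by blast
  have step_back: "?step (?step v a) (letter_inv a) = v" if "v \<in> ?V" "fst a \<in> S" for v a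
    using coset_mult_assoc[OF V_sub[OF that(1)], of "[a]" "[letter_inv a]"] that coset_mult_one[OF V_sub[OF that(1)]]
    by (simp add: letter_in_free_group)
  have step: "?c (p @ [a]) = ?step (?c p) a" if "p @ [a] \<in> carrier (free_group S)" for p a
    using coset_mult_assoc[OF H_sub, of p "[a]"] append_in_free_groupD[OF that] foldr_push_reduced[of p "[a]"] that
    by (simp add: carrier_free_group)
  have inj: "inj_on (\<lambda>v. ?step v (x, True)) ?V" if "x \<in> S" for x
    using step_back[where a = "(x, True)"] that by (intro inj_on_inverseI[of _ "\<lambda>v. ?step v (x, False)"]) (simp add: letter_inv_def)
  \<comment> \<open>Otherwise each generator maps the finite set \<open>?V\<close> to itself
    injectively, hence bijectively, so inverse letters stay inside as well; then \<open>?V\<close>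
    contains all cosets and the index is finite.\<close>
  have "\<exists>v\<in>?V. \<exists>x\<in>S. ?step v (x, True) \<notin> ?V"
  proof (rule ccontr)
    assume "\<not> (\<exists>v\<in>?V. \<exists>x\<in>S. ?step v (x, True) \<notin> ?V)"
    then have closed: "?step v (x, True) \<in> ?V" if "v \<in> ?V" "x \<in> S" for v x using that by blast
    have closed': "?step v (x, False) \<in> ?V" if "v \<in> ?V" "x \<in> S" for v x
    proof -
      have "(\<lambda>v. ?step v (x, True)) ` ?V = ?V"
        using closed that by (intro endo_inj_surj fin inj) auto
      then have "v \<in> (\<lambda>v. ?step v (x, True)) ` ?V" using that(1) by simp
      then obtain u where "u \<in> ?V" "v = ?step u (x, True)" by (rule imageE)
      then show ?thesis using step_back[of u "(x, True)"] that by (simp add: letter_inv_def)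
    qed
    have "?c p \<in> ?V" if "p \<in> carrier (free_group S)" for p
      using that
    proof (induction p rule: rev_induct)
      case Nil
      then show ?case using base base_in by simp
    next
      case (snoc a p)
      then have "?c p \<in> ?V" "fst a \<in> S"
        using append_in_free_groupD[OF snoc.prems] by (simp_all add: letter_in_free_group)
      then show ?case
        unfolding step[OF snoc.prems] using closed closed' by (cases a; cases "snd a") auto
    qed
    then have "rcosets\<^bsub>free_group S\<^esub> H \<subseteq> ?V" by (auto simp: RCOSETS_def)
    then show False using inf fin finite_subset by (auto simp: has_finite_index_def)
  qed
  then obtain v0 x0 where v0: "v0 \<in> ?V" "x0 \<in> S" "?step v0 (x0, True) \<notin> ?V" by blast
  have "\<exists>p. p permutes ?V \<and> (x \<in> S \<longrightarrow> (\<forall>v\<in>?V. ?step v (x, True) \<in> ?V \<longrightarrow> p v = ?step v (x, True)))" for x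
  proof (cases "x \<in> S")
    case True
    have "\<exists>p. p permutes ?V \<and> (\<forall>v\<in>{v \<in> ?V. ?step v (x, True) \<in> ?V}. p v = ?step v (x, True))"
      using inj_on_subset[OF inj[OF True]] by (intro extend_injection_to_permutation fin) auto
    then show ?thesis by auto
  qed (auto intro: permutes_id)
  then obtain \<pi> where \<pi>: "\<And>x. \<pi> x permutes ?V"
    "\<And>x v. x \<in> S \<Longrightarrow> v \<in> ?V \<Longrightarrow> ?step v (x, True) \<in> ?V \<Longrightarrow> \<pi> x v = ?step v (x, True)"
    by metis
  have act: "letter_act \<pi> a v = ?step v a" if "fst a \<in> S" "v \<in> ?V" "?step v a \<in> ?V" for a v
  proof (cases "snd a")
    case True
    then show ?thesis using \<pi>(2)[of "fst a" v] that by (cases a) (simp add: letter_act_def)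
  next
    case False
    then have "\<pi> (fst a) (?step v a) = v"
      using \<pi>(2)[of "fst a" "?step v a"] that step_back[of v a] by (simp add: letter_inv_def)
    then show ?thesis using False permutes_inv_eq[OF \<pi>(1)] by (auto simp: letter_act_def)
  qed
  \<comment> \<open>Prefixes of elements of \<open>H\<close> stay in \<open>?V\<close>, so the path
    never uses an edge that was added by the completion.\<close>
  have run: "run \<pi> p H = ?c p" if "p @ q \<in> H" for p q
    using that
  proof (induction p arbitrary: q rule: rev_induct)
    case Nil
    then show ?case using base by simp
  next
    case (snoc a p)
    have pa: "p @ [a] \<in> carrier (free_group S)"
      using snoc.prems H_sub append_in_free_groupD by (metis append_assoc subsetD)
    have "?c p \<in> ?V" "?c (p @ [a]) \<in> ?V"
      using snoc.prems unfolding prefix_cosets_def by (fastforce simp: prefix_def)+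
    then show ?case
      using snoc.IH[of "a # q"] snoc.prems act[of a "?c p"] append_in_free_groupD[OF pa]
      unfolding step[OF pa] by (simp add: letter_in_free_group)
  qed
  obtain p0 r where p0: "p0 @ r \<in> H" "v0 = ?c p0"
    using v0(1) by (auto simp: prefix_cosets_def prefix_def)
  have run_p0: "run \<pi> p0 H = v0" using run[OF p0(1)] p0(2) by simp
  have p0_in: "p0 \<in> carrier (free_group S)"
    using append_in_free_groupD[of p0 r] p0(1) H_sub by blast
  \<comment> \<open>Along prefixes of elements of \<open>H\<close> the action computes true cosets,
    so reading \<open>x0\<close> at \<open>v0\<close> would put \<open>?step v0 (x0, True)\<close>
    into \<open>?V\<close>.\<close>
  have "run \<pi> p H \<noteq> run \<pi> p0 H" if pq: "p @ (x0, True) # q \<in> H" for p q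
  proof
    assume "run \<pi> p H = run \<pi> p0 H"
    then have "v0 = ?c p" using run_p0 run[OF pq] by simp
    moreover have "p @ [(x0, True)] \<in> carrier (free_group S)"
      using pq H_sub append_in_free_groupD[of "p @ [(x0, True)]" q] by auto
    ultimately have "?step v0 (x0, True) = ?c (p @ [(x0, True)])" by (simp add: step)
    also have "\<dots> \<in> ?V" using pq unfolding prefix_cosets_def by (fastforce simp: prefix_def)
    finally show False using v0 by simp
  qed
  then show ?thesis using fin \<pi>(1) base_in v0(2) p0_in by blast
qed

subsection \<open>Positive words crossing every edge of an orbit\<close>

definition pos_word :: "'a list \<Rightarrow> ('a \<times> bool) list" where
  "pos_word xs = map (\<lambda>x. (x, True)) xs"

lemma pos_word_simps [simp]:
  "pos_word [] = []" "pos_word (x # xs) = (x, True) # pos_word xs"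
  "pos_word (xs @ ys) = pos_word xs @ pos_word ys" "pos_word xs = [] \<longleftrightarrow> xs = []"
  "length (pos_word xs) = length xs" "fst ` set (pos_word xs) = set xs"
  by (auto simp: pos_word_def image_image)

lemma reduced_pos_word [simp]: "reduced (pos_word xs)"
  unfolding reduced_def pos_word_def successively_map
  by (auto simp: letter_inv_def successively_conv_nth)

lemma run_pos_word: "run \<pi> (pos_word xs) v = fold \<pi> xs v"
  by (induction xs arbitrary: v) (simp_all add: letter_act_def)

definition automorphism_pair ::
  "'a set \<Rightarrow> (('a \<times> bool) list \<Rightarrow> ('a \<times> bool) list) \<Rightarrow> (('a \<times> bool) list \<Rightarrow> ('a \<times> bool) list) \<Rightarrow> bool" where
  "automorphism_pair S \<Phi> \<Psi> \<longleftrightarrow>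
     \<Phi> \<in> hom (free_group S) (free_group S) \<and> \<Psi> \<in> hom (free_group S) (free_group S) \<and>
     (\<forall>w \<in> carrier (free_group S). \<Psi> (\<Phi> w) = w \<and> \<Phi> (\<Psi> w) = w)"

text \<open>Images are kept as lists of generators without signs, so that multiplying two of them is
  concatenation and cannot cancel.\<close>

definition positive_basis :: "'a set \<Rightarrow> ('a \<Rightarrow> 'a list) \<Rightarrow> bool" where
  "positive_basis S f \<longleftrightarrow> (\<forall>x\<in>S. set (f x) \<subseteq> S) \<and>
     (\<exists>\<Phi> \<Psi>. automorphism_pair S \<Phi> \<Psi> \<and> (\<forall>x\<in>S. \<Phi> [(x, True)] = pos_word (f x)))"

lemma positive_basis_id: "positive_basis S (\<lambda>x. [x])"
proof -
  have "(\<lambda>w. w) \<in> hom (free_group S) (free_group S)" by (auto intro: homI)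
  then have "automorphism_pair S (\<lambda>w. w) (\<lambda>w. w)" by (simp add: automorphism_pair_def)
  then show ?thesis unfolding positive_basis_def by fastforce
qed

lemma hom_id_on_generators:
  assumes "h \<in> hom (free_group S) (free_group S)" "\<And>x. x \<in> S \<Longrightarrow> h [(x, True)] = [(x, True)]"
    and "w \<in> carrier (free_group S)"
  shows "h w = w"
proof -
  have "(\<lambda>w. w) \<in> hom (free_group S) (free_group S)" by (auto intro: homI)
  then show ?thesis
    using hom_free_group_eqI[OF group_free_group assms(1) _ _ assms(3)] assms(2) by simp
qed

lemma transvection:
  assumes "i \<in> S" "j \<in> S" "i \<noteq> j"
  obtains \<tau> \<tau>' where "automorphism_pair S \<tau> \<tau>'" "\<tau> [(i, True)] = [(j, True), (i, True)]"
    "\<And>x. x \<in> S \<Longrightarrow> x \<noteq> i \<Longrightarrow> \<tau> [(x, True)] = [(x, True)]"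
proof -
  interpret group "free_group S" by (rule group_free_group)
  \<comment> \<open>The maps \<open>i \<mapsto> j i\<close> and \<open>i \<mapsto> j^-1 i\<close>
    are mutually inverse; the flag \<open>b\<close> is the sign of \<open>j\<close>, so one
    construction serves for both.\<close>
  define t where "t b x = (if x = i then [(j, b), (i, True)] else [(x, True)])" for b x
  have t_in: "t b \<in> S \<rightarrow> carrier (free_group S)" for b
    using assms by (auto simp: t_def carrier_free_group letter_inv_def)
  have "\<exists>h \<in> hom (free_group S) (free_group S). \<forall>x\<in>S. h [(x, True)] = t b x" for b
    by (rule free_group_universal[OF t_in])
  then obtain h where h: "h b \<in> hom (free_group S) (free_group S)"
    "x \<in> S \<Longrightarrow> h b [(x, True)] = t b x" for b x by metis
  have ji: "[(j, b), (i, True)] = foldr push [(j, b)] [(i, True)]" for b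
    using assms(3) by (simp add: letter_inv_def)
  have hj: "h b [(j, c)] = [(j, c)]" for b c
  proof (cases c)
    case True
    then show ?thesis using h(2) assms by (simp add: t_def)
  next
    case False
    then show ?thesis
      using hom_free_group_winv[OF group_free_group h(1), of "[(j, True)]" b] h(2)[of j b] assms
      by (simp add: t_def letter_in_free_group inv_free_group letter_inv_def)
  qed
  have inverse: "h b (h c w) = w" if "w \<in> carrier (free_group S)" "b \<noteq> c" for b c w
  proof -
    have "h b \<circ> h c \<in> hom (free_group S) (free_group S)"
      by (rule Group.hom_compose[OF h(1) h(1)])
    moreover have "(h b \<circ> h c) [(x, True)] = [(x, True)]" if "x \<in> S" for x
    proof (cases "x = i")
      case True
      have "h b [(j, c), (i, True)] = foldr push (h b [(j, c)]) (h b [(i, True)])"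
        unfolding ji using hom_mult[OF h(1), of "[(j, c)]" "[(i, True)]"] assms by (simp add: letter_in_free_group)
      also have "\<dots> = [(i, True)]"
        unfolding hj using h(2)[of i b] assms \<open>b \<noteq> c\<close> by (simp add: t_def letter_inv_def)
      finally show ?thesis using True h(2)[of i c] assms by (simp add: t_def)
    next
      case False
      then show ?thesis using h(2) that by (simp add: t_def)
    qed
    ultimately have "(h b \<circ> h c) w = w"
      using that(1) hom_id_on_generators[of "h b \<circ> h c" S w] by blast
    then show ?thesis by simp
  qed
  show thesis
  proof (rule that)
    show "automorphism_pair S (h True) (h False)"
      using h(1) inverse[of _ True False] inverse[of _ False True] by (simp add: automorphism_pair_def)
  qed (use h(2) assms in \<open>simp_all add: t_def\<close>)
qed

text \<open>The automorphism is precomposed with \<open>i \<mapsto> j i\<close>; positivity keeps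
  the concatenation \<open>f j @ f i\<close> reduced.\<close>

lemma positive_basis_transvection:
  assumes f: "positive_basis S f" and ij: "i \<in> S" "j \<in> S" "i \<noteq> j"
  shows "positive_basis S (f(i := f j @ f i))"
proof -
  obtain \<Phi> \<Psi> where P: "automorphism_pair S \<Phi> \<Psi>" "\<And>x. x \<in> S \<Longrightarrow> \<Phi> [(x, True)] = pos_word (f x)"
    using f by (auto simp: positive_basis_def)
  obtain \<tau> \<tau>' where T: "automorphism_pair S \<tau> \<tau>'" "\<tau> [(i, True)] = [(j, True), (i, True)]"
    "\<And>x. x \<in> S \<Longrightarrow> x \<noteq> i \<Longrightarrow> \<tau> [(x, True)] = [(x, True)]"
    using transvection[OF ij] by blast
  have homs: "\<Phi> \<in> hom (free_group S) (free_group S)" "\<Psi> \<in> hom (free_group S) (free_group S)"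
    "\<tau> \<in> hom (free_group S) (free_group S)" "\<tau>' \<in> hom (free_group S) (free_group S)"
    using P(1) T(1) by (simp_all add: automorphism_pair_def)
  have "automorphism_pair S (\<Phi> \<circ> \<tau>) (\<tau>' \<circ> \<Psi>)"
    unfolding automorphism_pair_def
  proof (intro conjI ballI)
    show "\<Phi> \<circ> \<tau> \<in> hom (free_group S) (free_group S)" "\<tau>' \<circ> \<Psi> \<in> hom (free_group S) (free_group S)"
      using homs by (blast intro: Group.hom_compose)+
    fix w assume "w \<in> carrier (free_group S)"
    then show "(\<tau>' \<circ> \<Psi>) ((\<Phi> \<circ> \<tau>) w) = w" "(\<Phi> \<circ> \<tau>) ((\<tau>' \<circ> \<Psi>) w) = w"
      using P(1) T(1) hom_in_carrier[OF homs(3)] hom_in_carrier[OF homs(2)]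
      by (simp_all add: automorphism_pair_def)
  qed
  moreover have "(\<Phi> \<circ> \<tau>) [(x, True)] = pos_word ((f(i := f j @ f i)) x)" if "x \<in> S" for x
  proof (cases "x = i")
    case True
    have "\<Phi> [(j, True), (i, True)] = foldr push (\<Phi> [(j, True)]) (\<Phi> [(i, True)])"
      using hom_free_group_Cons[OF homs(1), of "(j, True)" "[(i, True)]"] ij
      by (simp add: Cons_in_free_group letter_inv_def)
    also have "\<dots> = pos_word (f j @ f i)"
      using P(2) ij foldr_push_reduced[of "pos_word (f j)" "pos_word (f i)"] reduced_pos_word[of "f j @ f i"]
      by simp
    finally show ?thesis using True T(2) by simp
  qed (use T(3) P(2) that in simp)
  ultimately show ?thesis using f ij unfolding positive_basis_def by (auto split: if_splits)
qed

lemma positive_basis_power_transvection: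
  assumes "positive_basis S f" "i \<in> S" "j \<in> S" "i \<noteq> j"
  shows "positive_basis S (f(i := concat (replicate n (f j)) @ f i))"
proof (induction n)
  case 0
  then show ?case using assms by simp
next
  case (Suc n)
  from positive_basis_transvection[OF Suc assms(2-4)] show ?case
    using assms(4) by (simp add: fun_upd_other fun_upd_same del: fun_upd_apply)
qed

section \<open>Edges of the action graph, encoded by source and label\<close>

definition crossed :: "('a \<Rightarrow> 'v \<Rightarrow> 'v) \<Rightarrow> 'a list \<Rightarrow> 'v \<Rightarrow> ('v \<times> 'a) set" where
  "crossed \<pi> xs v = {(fold \<pi> ys v, x) | ys x. \<exists>zs. xs = ys @ x # zs}"

lemma crossed_append: "crossed \<pi> (xs @ ys) v = crossed \<pi> xs v \<union> crossed \<pi> ys (fold \<pi> xs v)"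
proof (intro equalityI subsetI)
  fix e assume "e \<in> crossed \<pi> (xs @ ys) v"
  then obtain us x zs where e: "e = (fold \<pi> us v, x)" "xs @ ys = us @ x # zs"
    by (auto simp: crossed_def)
  then consider ts where "xs = us @ x # ts" | ts where "us = xs @ ts" "ys = ts @ x # zs"
    by (auto simp: append_eq_append_conv2 append_eq_Cons_conv)
  then show "e \<in> crossed \<pi> xs v \<union> crossed \<pi> ys (fold \<pi> xs v)"
    by cases (use e in \<open>force simp: crossed_def\<close>)+
next
  fix e assume "e \<in> crossed \<pi> xs v \<union> crossed \<pi> ys (fold \<pi> xs v)"
  then show "e \<in> crossed \<pi> (xs @ ys) v"
  proof
    assume "e \<in> crossed \<pi> xs v"
    then show ?thesis unfolding crossed_def by (force intro: append_assoc)
  next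
    assume "e \<in> crossed \<pi> ys (fold \<pi> xs v)"
    then obtain us x zs where "e = (fold \<pi> us (fold \<pi> xs v), x)" "ys = us @ x # zs"
      by (auto simp: crossed_def)
    then have "e = (fold \<pi> (xs @ us) v, x)" "xs @ ys = (xs @ us) @ x # zs" by simp_all
    then show ?thesis unfolding crossed_def by blast
  qed
qed

lemma crossed_subset:
  assumes "\<And>x. \<pi> x permutes V" "set xs \<subseteq> S" "v \<in> V"
  shows "crossed \<pi> xs v \<subseteq> V \<times> S"
proof -
  have "fold \<pi> ys v \<in> V" for ys
    using run_in[OF assms(1), where w = "pos_word ys" and v = v] assms(3) by (simp add: run_pos_word)
  then show ?thesis using assms(2) by (auto simp: crossed_def)
qed

lemma fold_concat_replicate: "fold \<pi> (concat (replicate n xs)) v = (fold \<pi> xs ^^ n) v"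
  by (induction n arbitrary: v) (simp_all add: funpow_swap1)

lemma permutes_finite_order:
  assumes "finite V" "p permutes V"
  obtains n where "n \<ge> 2" "p ^^ n = id"
proof -
  obtain n where n: "p ^^ n = id" "n > 0"
    using permutation_is_nilpotent[of p] assms permutation_permutes by blast
  \<comment> \<open>Doubling secures an exponent of at least two, even when \<open>p\<close> is the
    identity.\<close>
  have "p ^^ (n + n) = id" unfolding funpow_add n(1) by simp
  then show thesis using that[of "n + n"] n(2) by simp
qed

text \<open>The first copy of \<open>xs\<close> is read from \<open>v\<close>, the second from
  \<open>fold \<pi> xs v\<close> (whence \<open>n \<ge> 2\<close>), and all \<open>n\<close> copies
  together return to \<open>v\<close>, so \<open>ys\<close> is still read from
  \<open>v\<close>.\<close>

lemma crossed_power_transvection: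
  assumes id: "(fold \<pi> xs) ^^ n = id" and n: "n \<ge> 2"
  shows "crossed \<pi> xs v \<subseteq> crossed \<pi> (concat (replicate n xs) @ ys) v"
    "crossed \<pi> xs (fold \<pi> xs v) \<subseteq> crossed \<pi> (concat (replicate n xs) @ ys) v"
    "crossed \<pi> ys v \<subseteq> crossed \<pi> (concat (replicate n xs) @ ys) v"
    "fold \<pi> (concat (replicate n xs) @ ys) v = fold \<pi> ys v"
proof -
  obtain m where "n = Suc (Suc m)" using n by (metis add_2_eq_Suc le_Suc_ex)
  then have "concat (replicate n xs) @ ys = xs @ xs @ concat (replicate m xs) @ ys" by simp
  then show "crossed \<pi> xs v \<subseteq> crossed \<pi> (concat (replicate n xs) @ ys) v"
    "crossed \<pi> xs (fold \<pi> xs v) \<subseteq> crossed \<pi> (concat (replicate n xs) @ ys) v"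
    by (auto simp: crossed_append)
  show "crossed \<pi> ys v \<subseteq> crossed \<pi> (concat (replicate n xs) @ ys) v"
    "fold \<pi> (concat (replicate n xs) @ ys) v = fold \<pi> ys v"
    using id by (simp_all add: crossed_append fold_concat_replicate)
qed

text \<open>Replacing \<open>f i\<close> by \<open>(f j)\<^sup>n f i\<close>, where \<open>\<pi> j\<close> has order dividing \<open>n\<close>, keeps the
  permutations induced by the words and all crossed edges. For a basis with a maximal number of
  crossed edges all words therefore cross the same edges, and these are all edges of the orbit.\<close>

lemma positive_basis_crossing_orbits:
  fixes \<pi> :: "'a \<Rightarrow> 'v \<Rightarrow> 'v"
  assumes fin: "finite S" "finite V" and perm: "\<And>x. \<pi> x permutes V" and card: "card S \<ge> 2"
  shows "\<exists>f. positive_basis S f \<and> (\<forall>i\<in>S. \<forall>x\<in>S. \<forall>v\<in>V. \<forall>p.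
    fst ` set p \<subseteq> S \<longrightarrow> (run \<pi> p v, x) \<in> crossed \<pi> (f i) v)"
proof -
  \<comment> \<open>Fixing the permutations induced by the words makes the exponent for
    \<open>\<pi> j\<close> valid for \<open>f j\<close> too. The last clause says that
    \<open>f i\<close> crosses the edges with its own label, from which the other edges are
    reached.\<close>
  define good where "good f \<longleftrightarrow> positive_basis S f \<and> (\<forall>i\<in>S. fold \<pi> (f i) = \<pi> i) \<and>
    (\<forall>i\<in>S. \<forall>v\<in>V. (v, i) \<in> crossed \<pi> (f i) v)" for f
  define T where "T f = {(i, v, e). i \<in> S \<and> v \<in> V \<and> e \<in> crossed \<pi> (f i) v}" for f
  have T_sub: "T f \<subseteq> S \<times> V \<times> V \<times> S" if "good f" for f
  proof -
    have "crossed \<pi> (f i) v \<subseteq> V \<times> S" if "i \<in> S" "v \<in> V" for i v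
      using that \<open>good f\<close> by (intro crossed_subset perm) (auto simp: good_def positive_basis_def)
    then show ?thesis by (fastforce simp: T_def)
  qed
  have fin_T: "finite (T f)" if "good f" for f
    using fin by (intro finite_subset[OF T_sub[OF that]]) auto
  have card_T: "card (T f) < Suc (card (S \<times> V \<times> V \<times> S))" if "good f" for f
    using T_sub[OF that] fin by (intro le_imp_less_Suc card_mono) auto
  have "good (\<lambda>x. [x])"
  proof -
    have "(v, i) \<in> crossed \<pi> [i] v" for v i
      unfolding crossed_def by (auto intro!: exI[of _ "[]"])
    then show ?thesis by (simp add: good_def positive_basis_id)
  qed
  then obtain f where f: "good f" and max: "\<And>g. good g \<Longrightarrow> card (T g) \<le> card (T f)"
    using ex_has_greatest_nat[of good _ "\<lambda>f. card (T f)" "Suc (card (S \<times> V \<times> V \<times> S))"] card_T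
    by metis
  have key: "crossed \<pi> (f j) v \<subseteq> crossed \<pi> (f i) v \<and> crossed \<pi> (f j) (\<pi> j v) \<subseteq> crossed \<pi> (f i) v"
    if ij: "i \<in> S" "j \<in> S" "i \<noteq> j" and v: "v \<in> V" for i j v
  proof -
    obtain n where n: "n \<ge> 2" "\<pi> j ^^ n = id"
      using permutes_finite_order[OF fin(2) perm[of j]] by metis
    have fj: "fold \<pi> (f j) = \<pi> j" and fi: "fold \<pi> (f i) = \<pi> i" using f ij by (simp_all add: good_def)
    define g where "g = f(i := concat (replicate n (f j)) @ f i)"
    note cr = crossed_power_transvection[where \<pi> = \<pi> and xs = "f j" and n = n and ys = "f i",
        unfolded fj, OF n(2,1)]
    have g_i: "g i = concat (replicate n (f j)) @ f i" and g_k: "k \<noteq> i \<Longrightarrow> g k = f k" for k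
      by (simp_all add: g_def)
    have mono: "crossed \<pi> (f k) w \<subseteq> crossed \<pi> (g k) w" for k w
      using cr(3)[of w] g_i g_k by (cases "k = i") auto
    have "fold \<pi> (g k) = \<pi> k" if "k \<in> S" for k
    proof (cases "k = i")
      case True
      show ?thesis unfolding True g_i using cr(4) fi by (intro ext) simp
    qed (use that f in \<open>simp add: g_k good_def\<close>)
    moreover have "positive_basis S g"
      unfolding g_def using f ij by (intro positive_basis_power_transvection) (simp_all add: good_def)
    moreover have "(w, k) \<in> crossed \<pi> (g k) w" if "k \<in> S" "w \<in> V" for k w
      using mono f that unfolding good_def by blast
    ultimately have g: "good g" by (simp add: good_def)
    \<comment> \<open>No crossed edge is lost, so maximality forces equality: what the copies of
      \<open>f j\<close> cross was already crossed by \<open>f i\<close>.\<close>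
    have "T f \<subseteq> T g" using mono by (auto simp: T_def)
    then have T_eq: "T f = T g"
      using max[OF g] fin_T[OF g] by (meson card_seteq)
    have "crossed \<pi> (g i) v = crossed \<pi> (f i) v"
    proof -
      have "e \<in> crossed \<pi> (g i) v \<longleftrightarrow> e \<in> crossed \<pi> (f i) v" for e
        using T_eq ij v unfolding T_def set_eq_iff by (cases e) auto
      then show ?thesis by blast
    qed
    then show ?thesis using cr(1,2)[of v] by (simp add: g_i)
  qed
  have other: "\<exists>k\<in>S. k \<noteq> i" for i
  proof (rule ccontr)
    assume "\<not> (\<exists>k\<in>S. k \<noteq> i)"
    then have "S \<subseteq> {i}" by blast
    then show False using card_mono[of "{i}" S] card by simp
  qed
  have same: "crossed \<pi> (f j) v = crossed \<pi> (f i) v" if "i \<in> S" "j \<in> S" "v \<in> V" for i j v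
    using key that by (cases "i = j") blast+
  have step: "crossed \<pi> (f i) (\<pi> j v) \<subseteq> crossed \<pi> (f i) v" if ij: "i \<in> S" "j \<in> S" "v \<in> V" for i j v
  proof -
    \<comment> \<open>\<open>key\<close> needs distinct indices, so the case \<open>i = j\<close>
      takes a detour through another index, which exists because \<open>S\<close> has at least two
      elements.\<close>
    obtain k where k: "k \<in> S" "k \<noteq> j" using other by blast
    have "\<pi> j v \<in> V" using permutes_in_image[OF perm, of j v] ij by simp
    then show ?thesis
      using key[OF k(1) ij(2) k(2) ij(3)] same[OF k(1) ij(1,3)] same[OF ij(2,1)] by simp
  qed
  have step_inv: "crossed \<pi> (f i) (inv_into UNIV (\<pi> j) v) \<subseteq> crossed \<pi> (f i) v"
    if ij: "i \<in> S" "j \<in> S" "v \<in> V" for i j v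
  proof -
    obtain n where n: "n \<ge> 2" "\<pi> j ^^ n = id"
      using permutes_finite_order[OF fin(2) perm[of j]] by metis
    have iter: "(\<pi> j ^^ m) v \<in> V \<and> crossed \<pi> (f i) ((\<pi> j ^^ m) v) \<subseteq> crossed \<pi> (f i) v" for m
    proof (induction m)
      case (Suc m)
      then show ?case
        using step[OF ij(1,2), of "(\<pi> j ^^ m) v"] permutes_in_image[OF perm, of j "(\<pi> j ^^ m) v"] by auto
    qed (use ij in simp)
    \<comment> \<open>By finite order, one step backwards equals \<open>n - 1\<close> steps
      forwards.\<close>
    have "\<pi> j ((\<pi> j ^^ (n - 1)) v) = (\<pi> j ^^ Suc (n - 1)) v" by simp
    also have "\<dots> = v" using n by simp
    finally have "inv_into UNIV (\<pi> j) v = (\<pi> j ^^ (n - 1)) v"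
      using permutes_inv_eq[OF perm] by metis
    then show ?thesis using iter[of "n - 1"] by simp
  qed
  have orbit: "crossed \<pi> (f i) (run \<pi> p v) \<subseteq> crossed \<pi> (f i) v"
    if "i \<in> S" "v \<in> V" "fst ` set p \<subseteq> S" for i v and p :: "('a \<times> bool) list"
    using that
  proof (induction p arbitrary: v)
    case (Cons a p)
    have "letter_act \<pi> a v \<in> V" using run_in[OF perm, where w = "[a]" and v = v] Cons.prems by simp
    moreover have "crossed \<pi> (f i) (letter_act \<pi> a v) \<subseteq> crossed \<pi> (f i) v"
      using step[of i "fst a" v] step_inv[of i "fst a" v] Cons.prems by (simp add: letter_act_def)
    ultimately show ?case using Cons.IH[of "letter_act \<pi> a v"] Cons.prems by auto
  qed simp
  show ?thesis
  proof (intro exI[of _ f] conjI ballI allI impI)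
    show "positive_basis S f" using f by (simp add: good_def)
    fix i x v and p :: "('a \<times> bool) list"
    assume a: "i \<in> S" "x \<in> S" "v \<in> V" "fst ` set p \<subseteq> S"
    have u: "run \<pi> p v \<in> V" using run_in[OF perm, where w = p and v = v] a by simp
    then have "(run \<pi> p v, x) \<in> crossed \<pi> (f x) (run \<pi> p v)" using f a by (simp add: good_def)
    then show "(run \<pi> p v, x) \<in> crossed \<pi> (f i) v"
      using same[OF a(1,2) u] orbit[OF a(1,3,4)] by blast
  qed
qed

subsection \<open>Avoiding the conjugates of the powers of a primitive element\<close>

lemma pow_pos_word: "pos_word xs [^]\<^bsub>free_group S\<^esub> (n::nat) = pos_word (concat (replicate n xs))"
proof (induction n)
  case (Suc n)
  have "concat (replicate n xs) @ xs = concat (replicate (Suc n) xs)"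
    by (induction n) simp_all
  then show ?case
    using Suc foldr_push_reduced[of "pos_word (concat (replicate n xs))" "pos_word xs"]
      reduced_pos_word[of "concat (replicate (Suc n) xs)"]
    by (metis mult_free_group nat_pow_Suc pos_word_simps(3))
qed simp

lemma (in group) pow_conjugate:
  assumes "g \<in> carrier G" "x \<in> carrier G"
  shows "(g \<otimes> x \<otimes> inv g) [^] (n::nat) = g \<otimes> x [^] n \<otimes> inv g"
proof (induction n)
  case (Suc n)
  have "inv g \<otimes> (g \<otimes> (x \<otimes> inv g)) = x \<otimes> inv g"
    using assms by (simp add: m_assoc[symmetric])
  then show ?case using Suc assms by (simp add: m_assoc)
qed (use assms in simp)

text \<open>If \<open>n \<ge> 2|g| + 1\<close>, then the middle of \<open>z\<^sup>n\<close> survives the reduction of \<open>g z\<^sup>n g\<^sup>-\<^sup>1\<close>, and the part of the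
  path that reads it crosses the missing edge.\<close>

lemma conjugate_power_not_mem:
  assumes H: "subgroup H (free_group S)"
    and perm: "\<And>x. \<pi> x permutes V" and base: "base \<in> V"
    and missing: "\<And>p q. p @ (x0, True) # q \<in> H \<Longrightarrow> run \<pi> p base \<noteq> run \<pi> p0 base"
    and p0: "fst ` set p0 \<subseteq> S"
    and xs: "set xs \<subseteq> S"
    and cross: "\<And>p v. v \<in> V \<Longrightarrow> fst ` set p \<subseteq> S \<Longrightarrow> (run \<pi> p v, x0) \<in> crossed \<pi> xs v"
    and g: "g \<in> carrier (free_group S)" and m: "m \<ge> 1"
  shows "g \<otimes>\<^bsub>free_group S\<^esub> pos_word xs [^]\<^bsub>free_group S\<^esub> (m::nat) \<otimes>\<^bsub>free_group S\<^esub> inv\<^bsub>free_group S\<^esub> g \<notin> H"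
proof
  interpret group "free_group S" by (rule group_free_group)
  let ?Z = "\<lambda>n. pos_word (concat (replicate n xs))"
  assume "g \<otimes>\<^bsub>free_group S\<^esub> pos_word xs [^]\<^bsub>free_group S\<^esub> m \<otimes>\<^bsub>free_group S\<^esub> inv\<^bsub>free_group S\<^esub> g \<in> H"
  moreover have z: "pos_word xs \<in> carrier (free_group S)" using xs by (simp add: carrier_free_group)
  moreover define n where "n = 2 * length g + 1"
  ultimately have "g \<otimes>\<^bsub>free_group S\<^esub> pos_word xs [^]\<^bsub>free_group S\<^esub> (m * n) \<otimes>\<^bsub>free_group S\<^esub> inv\<^bsub>free_group S\<^esub> g \<in> H"
    using pow_conjugate[of g "pos_word xs [^]\<^bsub>free_group S\<^esub> m" n] g
      subgroup_int_pow_closed[OF H, of _ "int n"]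
    by (metis int_pow_int nat_pow_closed nat_pow_pow)
  then have h: "foldr push (foldr push g (?Z (m * n))) (winv g) \<in> H"
    using g by (simp add: pow_pos_word inv_free_group)
  have ne: "xs \<noteq> []" using cross[OF base, of "[]"] by (auto simp: crossed_def)
  \<comment> \<open>One copy of \<open>xs\<close> is singled out; \<open>length g\<close> copies on
    its left shield it from \<open>g\<close>, and the \<open>k \<ge> length g\<close> copies on its
    right shield it from the inverse of \<open>g\<close>.\<close>
  define k where "k = m * n - Suc (length g)"
  have "n \<le> m * n" using m by simp
  then have mn: "m * n = length g + Suc k" and k: "length g \<le> k"
    unfolding k_def n_def by linarith+
  have long: "i \<le> length (?Z i)" for i
    using ne by (induction i) (auto simp: Suc_le_eq neq_Nil_conv)
  have Z_split: "?Z (m * n) = ?Z (length g) @ (pos_word xs @ ?Z k)"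
    unfolding mn replicate_add by simp
  define y where "y = foldr push g (?Z (length g))"
  have gz: "foldr push g (?Z (m * n)) = y @ pos_word xs @ ?Z k"
    unfolding Z_split y_def by (rule foldr_push_append_long) (rule long)
  have "?Z (m * n) \<in> carrier (free_group S)" using xs by (auto simp: carrier_free_group)
  then have yz: "y @ pos_word xs @ ?Z k \<in> carrier (free_group S)"
    using m_closed[OF g] unfolding gz[symmetric] by simp
  have "foldr push ((y @ pos_word xs) @ ?Z k) (winv g) = (y @ pos_word xs) @ foldr push (?Z k) (winv g)"
    using yz g k long[of k] by (intro foldr_push_append_long_right) (auto simp: carrier_free_group)
  then have mem: "y @ pos_word xs @ foldr push (?Z k) (winv g) \<in> H" (is "_ @ _ @ ?r \<in> H")
    using h unfolding gz by (simp del: foldr_append)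
  \<comment> \<open>Going back along \<open>y\<close> and then along \<open>p0\<close> leads from
    the start of the surviving copy to the source of the missing edge, so that edge lies in the
    orbit which the copy crosses completely.\<close>
  have "run \<pi> (winv y @ p0) (run \<pi> y base) = run \<pi> p0 base"
    using run_winv[where \<pi> = \<pi>, OF perm, where w = y and v = base] by simp
  moreover have "fst ` set (winv y @ p0) \<subseteq> S"
    using append_in_free_groupD[OF yz] p0 by (simp add: carrier_free_group image_Un)
  moreover have "run \<pi> y base \<in> V" using run_in[OF perm, where w = y and v = base] base by simp
  ultimately have "(run \<pi> p0 base, x0) \<in> crossed \<pi> xs (run \<pi> y base)"
    using cross by metis
  then obtain us zs where "xs = us @ x0 # zs" "run \<pi> p0 base = fold \<pi> us (run \<pi> y base)"
    by (auto simp: crossed_def)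
  then show False
    using missing[of "y @ pos_word us" "pos_word zs @ ?r"] mem by (simp add: run_pos_word)
qed

text \<open>Along a run of \<open>a\<close> inside an element of \<open>H\<close>, every coset met
  is a vertex of the finite core graph. A run longer than the number of vertices repeats one, which
  puts a conjugate of \<open>a^(j - i)\<close> into \<open>H\<close>. Runs of the inverse letter
  follow by inversion.\<close>

lemma bounded_powers_in_subgroup:
  assumes fg: "finitely_generated_subgroup H (free_group S)" and a: "a \<in> S"
    and conj: "\<And>g m. g \<in> carrier (free_group S) \<Longrightarrow> m \<ge> 1 \<Longrightarrow>
      g \<otimes>\<^bsub>free_group S\<^esub> [(a, True)] [^]\<^bsub>free_group S\<^esub> (m::nat) \<otimes>\<^bsub>free_group S\<^esub> inv\<^bsub>free_group S\<^esub> g \<notin> H"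
  shows "\<exists>M\<ge>1. \<forall>N\<ge>M. \<forall>p b q. p @ replicate N (a, b) @ q \<notin> H"
proof -
  interpret group "free_group S" by (rule group_free_group)
  have H: "subgroup H (free_group S)" using fg by (simp add: finitely_generated_subgroup_def)
  note H_sub = subgroup.subset[OF H]
  let ?c = "\<lambda>p. H #>\<^bsub>free_group S\<^esub> p"
  have rep_pow: "replicate n (a, True) = [(a, True)] [^]\<^bsub>free_group S\<^esub> n" for n :: nat
  proof -
    have "concat (replicate n [a]) = replicate n a" by (induction n) simp_all
    then show ?thesis using pow_pos_word[where xs = "[a]" and S = S and n = n] by (simp add: pos_word_def)
  qed
  have al: "[(a, True)] \<in> carrier (free_group S)" using a by (simp add: letter_in_free_group)
  have pos: "p @ replicate N (a, True) @ q \<notin> H" if N: "N > card (prefix_cosets S H)" for N p q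
  proof
    assume h: "p @ replicate N (a, True) @ q \<in> H"
    have split: "p @ replicate N (a, True) @ q = (p @ replicate i (a, True)) @ replicate (N - i) (a, True) @ q"
      if "i \<le> N" for i
      using that by (simp add: replicate_add[symmetric])
    have pre: "?c (p @ replicate i (a, True)) \<in> prefix_cosets S H" "p @ replicate i (a, True) \<in> carrier (free_group S)"
      if "i \<le> N" for i
    proof -
      have "prefix (p @ replicate i (a, True)) (p @ replicate N (a, True) @ q)"
        unfolding split[OF that] prefix_def by blast
      then show "?c (p @ replicate i (a, True)) \<in> prefix_cosets S H"
        unfolding prefix_cosets_def using h by blast
      show "p @ replicate i (a, True) \<in> carrier (free_group S)"
        using append_in_free_groupD[of "p @ replicate i (a, True)"] h H_sub unfolding split[OF that] by blast
    qed
    have "\<not> inj_on (\<lambda>i. ?c (p @ replicate i (a, True))) {0..N}"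
    proof
      assume "inj_on (\<lambda>i. ?c (p @ replicate i (a, True))) {0..N}"
      then have "card {0..N} \<le> card (prefix_cosets S H)"
        using pre(1) by (intro card_inj_on_le finite_prefix_cosets[OF fg]) auto
      then show False using N by simp
    qed
    then obtain i j where ij: "i < j" "j \<le> N" "?c (p @ replicate i (a, True)) = ?c (p @ replicate j (a, True))"
      unfolding inj_on_def by (metis atLeastAtMost_iff linorder_neqE_nat)
    let ?P = "\<lambda>i. p @ replicate i (a, True)"
    have p: "p \<in> carrier (free_group S)" using pre(2)[of 0] by simp
    have prod: "?P i = p \<otimes>\<^bsub>free_group S\<^esub> [(a, True)] [^]\<^bsub>free_group S\<^esub> i" if "i \<le> N" for i
      using pre(2)[OF that] foldr_push_reduced[of p "replicate i (a, True)"]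
      by (simp add: carrier_free_group flip: rep_pow)
    have "?P j \<otimes>\<^bsub>free_group S\<^esub> inv\<^bsub>free_group S\<^esub> ?P i \<in> H"
    proof -
      have "H #>\<^bsub>free_group S\<^esub> (?P j \<otimes>\<^bsub>free_group S\<^esub> inv\<^bsub>free_group S\<^esub> ?P i) = H"
        using ij pre(2) by (intro coset_mult_inv2 H_sub) auto
      then show ?thesis
        using ij pre(2) by (intro coset_join1[OF _ _ H] m_closed inv_closed) auto
    qed
    moreover have "?P j \<otimes>\<^bsub>free_group S\<^esub> inv\<^bsub>free_group S\<^esub> ?P i =
      p \<otimes>\<^bsub>free_group S\<^esub> [(a, True)] [^]\<^bsub>free_group S\<^esub> (j - i) \<otimes>\<^bsub>free_group S\<^esub> inv\<^bsub>free_group S\<^esub> p"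
    proof -
      define A where "A = (\<lambda>n::nat. [(a, True)] [^]\<^bsub>free_group S\<^esub> n)"
      have A: "A n \<in> carrier (free_group S)" for n using al by (simp add: A_def)
      have Aj: "A j = A (j - i) \<otimes>\<^bsub>free_group S\<^esub> A i"
        unfolding A_def nat_pow_mult[OF al] using ij(1) by simp
      have e: "A i \<otimes>\<^bsub>free_group S\<^esub> (inv\<^bsub>free_group S\<^esub> (A i) \<otimes>\<^bsub>free_group S\<^esub> inv\<^bsub>free_group S\<^esub> p) = inv\<^bsub>free_group S\<^esub> p"
        using m_assoc[of "A i" "inv\<^bsub>free_group S\<^esub> (A i)" "inv\<^bsub>free_group S\<^esub> p"] A p
        by (simp del: mult_free_group one_free_group)
      have "p \<otimes>\<^bsub>free_group S\<^esub> A j \<otimes>\<^bsub>free_group S\<^esub> inv\<^bsub>free_group S\<^esub> (p \<otimes>\<^bsub>free_group S\<^esub> A i) =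
         p \<otimes>\<^bsub>free_group S\<^esub> A (j - i) \<otimes>\<^bsub>free_group S\<^esub> inv\<^bsub>free_group S\<^esub> p"
        unfolding Aj using A p e by (simp add: m_assoc inv_mult_group del: mult_free_group one_free_group)
      then show ?thesis using ij by (simp add: prod A_def del: mult_free_group)
    qed
    ultimately show False using conj[OF p, of "j - i"] ij by simp
  qed
  have neg: "p @ replicate N (a, False) @ q \<notin> H" if "N > card (prefix_cosets S H)" for N p q
  proof
    assume h: "p @ replicate N (a, False) @ q \<in> H"
    then have "winv (p @ replicate N (a, False) @ q) \<in> H"
      using subgroup.m_inv_closed[OF H h] H_sub inv_free_group[of "p @ replicate N (a, False) @ q" S] by auto
    moreover have "winv (replicate N (a, False)) = replicate N (a, True)"
      by (simp add: winv_def map_replicate letter_inv_def)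
    ultimately show False using pos[OF that, of "winv q" "winv p"] by simp
  qed
  have "p @ replicate N (a, b) @ q \<notin> H" if "N > card (prefix_cosets S H)" for N p b q
    using pos[OF that] neg[OF that] by (cases b) auto
  then show ?thesis by (intro exI[of _ "Suc (card (prefix_cosets S H))"]) auto
qed

subsection \<open>Homomorphisms onto the free group of rank two\<close>

text \<open>The letters \<open>0\<close> and \<open>1\<close> play the roles of
  \<open>\<alpha>\<close> and \<open>\<beta>\<close>; this is the reduced word for
  \<open>\<alpha>^n\<close> with an integer exponent.\<close>

definition zero_power :: "int \<Rightarrow> (nat \<times> bool) list" where
  "zero_power n = replicate (nat \<bar>n\<bar>) (0, n \<ge> 0)"

definition letter_sign :: "bool \<Rightarrow> int" where
  "letter_sign b = (if b then 1 else -1)"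

lemma zero_power_0 [simp]: "zero_power 0 = []"
  by (simp add: zero_power_def)

lemma zero_power_eq_Nil_iff [simp]: "zero_power n = [] \<longleftrightarrow> n = 0"
  by (simp add: zero_power_def)

lemma winv_zero_power: "winv (zero_power n) = zero_power (- n)"
  by (cases "n = 0") (auto simp: zero_power_def winv_def map_replicate letter_inv_def)

lemma replicate_int_Cons:
  assumes "b \<longleftrightarrow> n \<ge> 0 \<or> n = 0 \<and> b"
  shows "(x, b) # replicate (nat \<bar>n\<bar>) (x, n \<ge> 0) =
    replicate (nat \<bar>n + letter_sign b\<bar>) (x, n + letter_sign b \<ge> 0)"
proof (cases b)
  case True
  then have "nat \<bar>n + 1\<bar> = Suc (nat \<bar>n\<bar>)" "n \<ge> 0" "n + 1 \<ge> 0" using assms by auto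
  then show ?thesis using True by (simp add: letter_sign_def)
next
  case False
  then have "nat \<bar>n - 1\<bar> = Suc (nat \<bar>n\<bar>)" "\<not> n - 1 \<ge> 0" "n = 0 \<or> \<not> n \<ge> 0" using assms by auto
  then show ?thesis using False by (auto simp: letter_sign_def)
qed

lemma push_zero_power:
  assumes "y = [] \<or> fst (hd y) \<noteq> 0"
  shows "push (0, b) (zero_power n @ y) = zero_power (n + letter_sign b) @ y"
proof (cases "n = 0 \<or> (b \<longleftrightarrow> n \<ge> 0)")
  case True
  then have "push (0, b) (zero_power n @ y) = (0, b) # zero_power n @ y"
    using assms by (cases "nat \<bar>n\<bar>"; cases y) (auto simp: zero_power_def letter_inv_def)
  also have "\<dots> = zero_power (n + letter_sign b) @ y"
  proof (cases "n = 0")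
    case True
    then show ?thesis by (simp add: zero_power_def letter_sign_def)
  next
    case False
    then show ?thesis using replicate_int_Cons[of b n 0] \<open>n = 0 \<or> (b \<longleftrightarrow> n \<ge> 0)\<close>
      by (simp add: zero_power_def)
  qed
  finally show ?thesis .
next
  case False
  let ?m = "n + letter_sign b"
  have "zero_power n = (0, \<not> b) # zero_power ?m"
  proof (cases b)
    case True
    then have "nat \<bar>n\<bar> = Suc (nat \<bar>n + 1\<bar>)" "\<not> n \<ge> 0" "n + 1 = 0 \<or> \<not> n + 1 \<ge> 0" using False by auto
    then show ?thesis using True by (auto simp: zero_power_def letter_sign_def)
  next
    case b: False
    then have "nat \<bar>n\<bar> = Suc (nat \<bar>n - 1\<bar>)" "n \<ge> 0" "n - 1 \<ge> 0" using False by auto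
    then show ?thesis using b by (simp add: zero_power_def letter_sign_def)
  qed
  then show ?thesis by (simp add: letter_inv_def)
qed

lemma foldr_push_zero_power:
  assumes "y = [] \<or> fst (hd y) \<noteq> 0"
  shows "foldr push (zero_power m) (zero_power n @ y) = zero_power (m + n) @ y"
proof -
  have "foldr push (replicate k (0, b)) (zero_power n @ y) = zero_power (letter_sign b * int k + n) @ y" for k b
  proof (induction k)
    case (Suc k)
    then show ?case
      using push_zero_power[OF assms, of b "letter_sign b * int k + n"] by (simp add: algebra_simps)
  qed simp
  moreover have "letter_sign (m \<ge> 0) * int (nat \<bar>m\<bar>) = m" by (simp add: letter_sign_def)
  ultimately show ?thesis unfolding zero_power_def[of m] by metis
qed

lemma reduced_zero_power: "reduced (zero_power n)"
  by (induction "nat \<bar>n\<bar>") (auto simp: zero_power_def reduced_def successively_conv_nth letter_inv_def)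

lemma reduced_one_zero_power:
  assumes "y = [] \<or> fst (hd y) \<noteq> 0" "reduced y" "n \<noteq> 0 \<or> y = [] \<or> hd y \<noteq> letter_inv (1, e)"
  shows "reduced ((1, e) # zero_power n @ y)"
proof -
  have "reduced (zero_power n @ y)"
    using assms reduced_zero_power[of n] unfolding reduced_append_iff
    by (cases "n = 0") (auto simp: zero_power_def last_replicate letter_inv_def prod_eq_iff)
  then show ?thesis
    using assms by (cases "n = 0") (auto simp: reduced_Cons_iff zero_power_def letter_inv_def hd_append hd_replicate)
qed

text \<open>The generators \<open>x \<noteq> a\<close> are mapped to \<open>\<alpha>\<^sup>q \<beta> \<alpha>\<^sup>q\<close> with distinct multiples \<open>q\<close> of \<open>L\<close>. An exponent of \<open>a\<close>
  smaller than \<open>L\<close> between two such generators is recovered from the image modulo \<open>L\<close>, so that no \<open>\<beta>\<close> is cancelled.\<close>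

lemma separating_hom_normal_form:
  fixes \<rho> :: "('a \<times> bool) list \<Rightarrow> (nat \<times> bool) list"
  assumes hom: "\<rho> \<in> hom (free_group S) (free_group {0, 1})"
    and rho_a: "\<And>b. \<rho> [(a, b)] = [(0, b)]"
    and rho: "\<And>s e. s \<in> S \<Longrightarrow> s \<noteq> a \<Longrightarrow>
      \<rho> [(s, e)] = zero_power (letter_sign e * q s) @ (1, e) # zero_power (letter_sign e * q s)"
    and q: "inj_on q (S - {a})" "\<And>s. int L dvd q s"
    and w: "w \<in> carrier (free_group S)" "\<And>p b r. w \<noteq> p @ replicate L (a, b) @ r"
  shows "\<exists>n. (w = replicate (nat \<bar>n\<bar>) (a, n \<ge> 0) \<and> \<rho> w = zero_power n) \<or>
    (\<exists>s e r y. w = replicate (nat \<bar>n\<bar>) (a, n \<ge> 0) @ (s, e) # r \<and> s \<in> S \<and> s \<noteq> a \<and>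
       \<rho> w = zero_power (n + letter_sign e * q s) @ (1, e) # y \<and> reduced ((1, e) # y))"
  using w
proof (induction w)
  case Nil
  show ?case
    using hom_one[OF hom group_free_group group_free_group] by (intro exI[of _ 0]) simp
next
  case (Cons l w)
  have w: "w \<in> carrier (free_group S)" "fst l \<in> S" "w = [] \<or> hd w \<noteq> letter_inv l"
    using Cons.prems(1) by (simp_all add: Cons_in_free_group)
  have no_run: "w \<noteq> p @ replicate L (a, b) @ r" for p b r
    using Cons.prems(2)[of "l # p" b r] by simp
  have rho_Cons: "\<rho> (l # w) = foldr push (\<rho> [l]) (\<rho> w)"
    using hom_free_group_Cons[OF hom Cons.prems(1)] by simp
  let ?A = "\<lambda>n::int. replicate (nat \<bar>n\<bar>) (a, n \<ge> 0)"
  from Cons.IH[OF w(1) no_run] obtain n where n: "(w = ?A n \<and> \<rho> w = zero_power n) \<or>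
    (\<exists>s e r y. w = ?A n @ (s, e) # r \<and> s \<in> S \<and> s \<noteq> a \<and>
       \<rho> w = zero_power (n + letter_sign e * q s) @ (1, e) # y \<and> reduced ((1, e) # y))"
    by blast
  show ?case
  proof (cases "fst l = a")
    case True
    then obtain b where l: "l = (a, b)" by (cases l) auto
    have "b \<longleftrightarrow> n \<ge> 0 \<or> n = 0 \<and> b" if "n \<noteq> 0"
    proof -
      have "hd w = (a, n \<ge> 0)" "w \<noteq> []" using n that by (auto simp: hd_append hd_replicate)
      then show ?thesis using w(3) l that by (auto simp: letter_inv_def)
    qed
    then have A: "(a, b) # ?A n = ?A (n + letter_sign b)"
      using replicate_int_Cons[of b n a] by (cases "n = 0") (auto simp: letter_sign_def)
    have rho_l: "\<rho> (l # w) = push (0, b) (\<rho> w)" using rho_Cons by (simp add: l rho_a)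
    from n show ?thesis
    proof (elim disjE conjE exE)
      assume "w = ?A n" "\<rho> w = zero_power n"
      then have "l # w = ?A (n + letter_sign b)" "\<rho> (l # w) = zero_power (n + letter_sign b)"
        unfolding rho_l using push_zero_power[of "[]" b n] A l by simp_all
      then show ?thesis by blast
    next
      fix s e r y
      assume "w = ?A n @ (s, e) # r" "s \<in> S" "s \<noteq> a" "reduced ((1, e) # y)"
        "\<rho> w = zero_power (n + letter_sign e * q s) @ (1, e) # y"
      moreover from this have "l # w = ?A (n + letter_sign b) @ (s, e) # r"
        "\<rho> (l # w) = zero_power ((n + letter_sign b) + letter_sign e * q s) @ (1, e) # y"
        unfolding rho_l using push_zero_power[of "(1, e) # y" b "n + letter_sign e * q s"] A l
        by (simp_all add: algebra_simps)
      ultimately show ?thesis by blast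
    qed
  next
    case False
    then obtain s' e' where l: "l = (s', e')" "s' \<noteq> a" "s' \<in> S" using w(2) by (cases l) auto
    let ?m = "letter_sign e' * q s'"
    \<comment> \<open>Prepending the image of \<open>l\<close> adds \<open>?m\<close> to the
      exponent of \<open>\<alpha>\<close> behind the new \<open>\<beta>\<close> letter. That letter
      could cancel only across exponent zero against its inverse, which the last assumption
      excludes.\<close>
    have result: ?thesis
      if y: "y = [] \<or> fst (hd y) \<noteq> 0" "reduced y" and rho_w: "\<rho> w = zero_power k @ y"
        and nc: "?m + k \<noteq> 0 \<or> y = [] \<or> hd y \<noteq> letter_inv (1, e')" for k y
    proof -
      let ?y = "zero_power (?m + k) @ y"
      have red: "reduced ((1, e') # ?y)" using y nc by (rule reduced_one_zero_power)
      have "\<rho> (l # w) = foldr push (zero_power ?m) (push (1, e') ?y)"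
        using rho_Cons foldr_push_zero_power[OF y(1)] by (simp add: l(1) rho[OF l(3,2)] rho_w)
      also have "\<dots> = zero_power ?m @ (1, e') # ?y"
        using foldr_push_zero_power[of "(1, e') # ?y" ?m 0] push_reduced[OF red] by simp
      finally show ?thesis
        using red l by (intro exI[of _ 0] disjI2) auto
    qed
    from n show ?thesis
    proof (elim disjE conjE exE)
      assume "\<rho> w = zero_power n"
      then show ?thesis using result[of "[]" n] by simp
    next
      fix s e r y
      assume a: "w = ?A n @ (s, e) # r" "s \<in> S" "s \<noteq> a" "reduced ((1, e) # y)"
        "\<rho> w = zero_power (n + letter_sign e * q s) @ (1, e) # y"
      \<comment> \<open>If the two \<open>\<beta>\<close> letters cancelled, \<open>n\<close> would
        be a multiple of \<open>L\<close> of absolute value below \<open>L\<close>, hence zero; then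
        \<open>s = s'\<close> by injectivity of \<open>q\<close>, and \<open>w\<close> would start
        with the inverse of \<open>l\<close>.\<close>
      have "?m + (n + letter_sign e * q s) \<noteq> 0 \<or> e = e'"
      proof (rule ccontr)
        assume "\<not> ?thesis"
        then have eq: "?m + (n + letter_sign e * q s) = 0" and e: "e = (\<not> e')" by auto
        then have n_eq: "n = letter_sign e' * (q s - q s')"
          by (cases e') (simp_all add: letter_sign_def)
        then have "int L dvd n" using q(2) by simp
        moreover have "\<bar>n\<bar> < int L"
        proof (rule ccontr)
          assume "\<not> ?thesis"
          then have "nat \<bar>n\<bar> = L + (nat \<bar>n\<bar> - L)" by simp
          then have "?A n = replicate L (a, n \<ge> 0) @ replicate (nat \<bar>n\<bar> - L) (a, n \<ge> 0)"
            by (metis replicate_add)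
          then show False 
            using no_run[of "[]" "n \<ge> 0" "replicate (nat \<bar>n\<bar> - L) (a, n \<ge> 0) @ (s, e) # r"] a(1) by simp
        qed
        ultimately have "n = 0" using zdvd_not_zless[of "\<bar>n\<bar>" "int L"] by auto
        moreover from this n_eq have "q s = q s'" by (simp add: letter_sign_def split: if_splits)
        ultimately have "w = (s', e) # r" using a l inj_onD[OF q(1), of s s'] by simp
        then show False using w(3) l e by (simp add: letter_inv_def)
      qed
      then show ?thesis
        using result[of "(1, e) # y" "n + letter_sign e * q s"] a by (auto simp: letter_inv_def)
    qed
  qed
qed

lemma separating_epimorphism:
  assumes "finite S" "a \<in> S" "b0 \<in> S" "b0 \<noteq> a" "L \<ge> 1"
  shows "\<exists>\<rho> \<in> epi (free_group S) (free_group {0::nat, 1}).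
    \<forall>w \<in> carrier (free_group S). w \<noteq> [] \<longrightarrow> (\<forall>p b r. w \<noteq> p @ replicate L (a, b) @ r) \<longrightarrow> \<rho> w \<noteq> []"
proof -
  let ?T = "free_group {0::nat, 1}"
  interpret T: group ?T by (rule group_free_group)
  obtain h :: "'a \<Rightarrow> nat" where h: "inj_on h S" using finite_imp_inj_to_nat_seg[OF assms(1)] by blast
  \<comment> \<open>Subtracting \<open>h b0\<close> makes \<open>q b0 = 0\<close>, so that
    \<open>b0\<close> is sent to \<open>\<beta>\<close> itself and surjectivity is
    immediate.\<close>
  define q where "q s = int L * (int (h s) - int (h b0))" for s
  have q: "inj_on q (S - {a})" "int L dvd q s" for s
    using h assms(5) by (auto simp: inj_on_def q_def)
  define g where "g s = (if s = a then [(0, True)] else zero_power (q s) @ (1, True) # zero_power (q s))" for s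
  have mem: "zero_power n @ (1, e) # zero_power n \<in> carrier ?T" for n e
  proof -
    have "fst ` set (zero_power n @ (1, e) # zero_power n) \<subseteq> {0, 1}" by (auto simp: zero_power_def)
    moreover have "reduced (zero_power n @ (1, e) # zero_power n)"
      using reduced_one_zero_power[of "[]" n e] reduced_zero_power[of n] unfolding reduced_append_iff
      by (cases "n = 0") (auto simp: zero_power_def last_replicate letter_inv_def)
    ultimately show ?thesis by (simp add: carrier_free_group)
  qed
  have "g \<in> S \<rightarrow> carrier ?T" using mem by (auto simp: g_def letter_in_free_group)
  from T.free_group_universal[OF this] obtain \<rho> where hom: "\<rho> \<in> hom (free_group S) ?T"
    and gen: "\<And>x. x \<in> S \<Longrightarrow> \<rho> [(x, True)] = g x" by blast
  have neg: "\<rho> [(x, False)] = winv (g x)" if "x \<in> S" for x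
  proof -
    have x: "[(x, True)] \<in> carrier (free_group S)" using that by (simp add: letter_in_free_group)
    have "\<rho> (winv [(x, True)]) = inv\<^bsub>?T\<^esub> \<rho> [(x, True)]"
      by (rule hom_free_group_winv[OF group_free_group hom x])
    then show ?thesis
      using hom_in_carrier[OF hom x] gen[OF that] by (simp add: inv_free_group letter_inv_def)
  qed
  have rho_a: "\<rho> [(a, b)] = [(0, b)]" for b
    using gen[OF assms(2)] neg[OF assms(2)] by (cases b) (simp_all add: g_def letter_inv_def)
  have rho: "\<rho> [(s, e)] = zero_power (letter_sign e * q s) @ (1, e) # zero_power (letter_sign e * q s)"
    if "s \<in> S" "s \<noteq> a" for s e
    using gen[OF that(1)] neg[OF that(1)] that(2)
    by (cases e) (simp_all add: g_def letter_sign_def letter_inv_def winv_zero_power)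
  interpret rho: group_hom "free_group S" ?T \<rho>
    by (intro group_hom.intro group_hom_axioms.intro group_free_group hom)
  have "carrier ?T \<subseteq> \<rho> ` carrier (free_group S)"
    unfolding free_group_generate[of "{0::nat, 1}", symmetric]
  proof (rule T.generate_subgroup_incl)
    have "[(0, True)] = \<rho> [(a, True)]" "[(1, True)] = \<rho> [(b0, True)]"
      using rho_a rho[of b0 True] assms by (simp_all add: q_def)
    then show "(\<lambda>x. [(x, True)]) ` {0::nat, 1} \<subseteq> \<rho> ` carrier (free_group S)"
      using assms by (auto simp: letter_in_free_group)
    show "subgroup (\<rho> ` carrier (free_group S)) ?T" by (rule rho.img_is_subgroup)
  qed
  then have "\<rho> \<in> epi (free_group S) ?T" using hom hom_in_carrier[OF hom] by (auto simp: epi_def)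
  moreover have "\<rho> w \<noteq> []"
    if w: "w \<in> carrier (free_group S)" "w \<noteq> []" "\<forall>p b r. w \<noteq> p @ replicate L (a, b) @ r" for w
    using separating_hom_normal_form[OF hom rho_a rho q w(1)] w(2,3) by fastforce
  ultimately show ?thesis by blast
qed

subsection \<open>The separating epimorphism\<close>

lemma run_equivariant:
  assumes "\<And>x. \<pi>1 x permutes V1" "\<And>x. \<pi> x permutes V" "\<And>x v. \<pi> x (\<iota> v) = \<iota> (\<pi>1 x v)"
  shows "run \<pi> p (\<iota> v) = \<iota> (run \<pi>1 p v)"
proof -
  have "inv_into UNIV (\<pi> x) (\<iota> v) = \<iota> (inv_into UNIV (\<pi>1 x) v)" for x v
    unfolding permutes_inv_eq[OF assms(2)] assms(3) using permutes_inverses[OF assms(1)] by simp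
  then have "letter_act \<pi> a (\<iota> v) = \<iota> (letter_act \<pi>1 a v)" for a v
    using assms(3) by (simp add: letter_act_def)
  then show ?thesis by (induction p arbitrary: v) simp_all
qed

lemma map_sum_permutes:
  assumes "p1 permutes V1" "p2 permutes V2"
  shows "map_sum p1 p2 permutes (Inl ` V1 \<union> Inr ` V2)"
  unfolding permutes_def
proof (intro conjI allI impI)
  fix v assume "v \<notin> Inl ` V1 \<union> Inr ` V2"
  then show "map_sum p1 p2 v = v"
    using permutes_not_in[OF assms(1)] permutes_not_in[OF assms(2)] by (cases v) auto
next
  fix v
  show "\<exists>!u. map_sum p1 p2 u = v"
  proof (rule ex1I)
    show "map_sum p1 p2 (map_sum (inv_into UNIV p1) (inv_into UNIV p2) v) = v"
      using permutes_inverses[OF assms(1)] permutes_inverses[OF assms(2)] by (cases v) simp_all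
    show "u = map_sum (inv_into UNIV p1) (inv_into UNIV p2) v" if "map_sum p1 p2 u = v" for u
      using that permutes_inverses[OF assms(1)] permutes_inverses[OF assms(2)] by (cases u) auto
  qed
qed

lemma finitely_generated_subgroup_image:
  assumes "group_hom G G' h" "finitely_generated_subgroup H G"
  shows "finitely_generated_subgroup (h ` H) G'"
proof -
  interpret group_hom G G' h by (rule assms(1))
  obtain A where H: "subgroup H G" and A: "finite A" "A \<subseteq> carrier G" "generate G A = H"
    using assms(2) by (auto simp: finitely_generated_subgroup_def)
  have "generate G' (h ` A) = h ` H" using generate_img[OF A(2)] A(3) by simp
  moreover have "h ` A \<subseteq> carrier G'" using A(2) by auto
  ultimately show ?thesis
    using subgroup_img_is_subgroup[OF H] A(1) unfolding finitely_generated_subgroup_def by blast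
qed

text \<open>One automorphism has to serve both subgroups, so the crossing lemma is applied to the
  disjoint union of the two completions. It shows that conjugates of powers of
  \<open>\<Phi> a\<close> avoid \<open>H\<close> and \<open>K\<close>; applying
  \<open>\<Psi>\<close> turns this into a statement about the basis element
  \<open>a\<close>.\<close>

lemma ex_automorphism_avoiding_powers:
  fixes S :: "'a set"
  assumes S: "finite S" "card S \<ge> 2" and a: "a \<in> S"
    and H: "finitely_generated_subgroup H (free_group S)" "\<not> has_finite_index H (free_group S)"
    and K: "finitely_generated_subgroup K (free_group S)" "\<not> has_finite_index K (free_group S)"
  shows "\<exists>\<Phi> \<Psi>. automorphism_pair S \<Phi> \<Psi> \<and>
    (\<forall>g \<in> carrier (free_group S). \<forall>m::nat. m \<ge> 1 \<longrightarrow>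
      g \<otimes>\<^bsub>free_group S\<^esub> [(a, True)] [^]\<^bsub>free_group S\<^esub> m \<otimes>\<^bsub>free_group S\<^esub> inv\<^bsub>free_group S\<^esub> g \<notin> \<Psi> ` H \<union> \<Psi> ` K)"
proof -
  obtain V1 :: "('a \<times> bool) list set set" and \<pi>1 b1 x1 p1 where 1:
    "finite V1" "\<And>x :: 'a. \<pi>1 x permutes V1" "b1 \<in> V1" "x1 \<in> S" "p1 \<in> carrier (free_group S)"
    "\<And>p q. p @ (x1, True) # q \<in> H \<Longrightarrow> run \<pi>1 p b1 \<noteq> run \<pi>1 p1 b1"
    using finite_completion_with_missing_edge[OF H] by blast
  obtain V2 :: "('a \<times> bool) list set set" and \<pi>2 b2 x2 p2 where 2:
    "finite V2" "\<And>x :: 'a. \<pi>2 x permutes V2" "b2 \<in> V2" "x2 \<in> S" "p2 \<in> carrier (free_group S)"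
    "\<And>p q. p @ (x2, True) # q \<in> K \<Longrightarrow> run \<pi>2 p b2 \<noteq> run \<pi>2 p2 b2"
    using finite_completion_with_missing_edge[OF K] by blast
  define \<pi> where "\<pi> x = map_sum (\<pi>1 x) (\<pi>2 x)" for x
  define V where "V = Inl ` V1 \<union> Inr ` V2"
  have perm: "\<pi> x permutes V" for x
    unfolding \<pi>_def V_def by (rule map_sum_permutes[OF 1(2) 2(2)])
  have runL: "run \<pi> p (Inl v) = Inl (run \<pi>1 p v)" for p v
    by (rule run_equivariant[OF 1(2) perm]) (simp add: \<pi>_def)
  have runR: "run \<pi> p (Inr v) = Inr (run \<pi>2 p v)" for p v
    by (rule run_equivariant[OF 2(2) perm]) (simp add: \<pi>_def)
  have "finite V" using 1(1) 2(1) by (simp add: V_def)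
  obtain f where f: "positive_basis S f" and f_cross: "\<forall>i\<in>S. \<forall>x\<in>S. \<forall>v\<in>V. \<forall>p.
      fst ` set p \<subseteq> S \<longrightarrow> (run \<pi> p v, x) \<in> crossed \<pi> (f i) v"
    using positive_basis_crossing_orbits[where \<pi> = \<pi> and V = V, OF S(1) \<open>finite V\<close> perm S(2)]
    by (elim exE conjE)
  have cross: "(run \<pi> p v, x) \<in> crossed \<pi> (f i) v"
    if "i \<in> S" "x \<in> S" "v \<in> V" "fst ` set p \<subseteq> S" for i x v p
    using f_cross that by simp
  obtain \<Phi> \<Psi> where P: "automorphism_pair S \<Phi> \<Psi>" and Phi: "\<And>x. x \<in> S \<Longrightarrow> \<Phi> [(x, True)] = pos_word (f x)"
    using f by (auto simp: positive_basis_def)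
  have fa: "set (f a) \<subseteq> S" using f a by (simp add: positive_basis_def)
  have notH: "g \<otimes>\<^bsub>free_group S\<^esub> pos_word (f a) [^]\<^bsub>free_group S\<^esub> m \<otimes>\<^bsub>free_group S\<^esub> inv\<^bsub>free_group S\<^esub> g \<notin> H"
    if "g \<in> carrier (free_group S)" "m \<ge> 1" for g and m :: nat
  proof (rule conjugate_power_not_mem[OF _ perm _ _ _ fa _ that])
    show "subgroup H (free_group S)" using H(1) by (simp add: finitely_generated_subgroup_def)
    show "Inl b1 \<in> V" using 1(3) by (simp add: V_def)
    show "run \<pi> p (Inl b1) \<noteq> run \<pi> p1 (Inl b1)" if "p @ (x1, True) # q \<in> H" for p q
      using 1(6)[OF that] by (simp add: runL)
    show "fst ` set p1 \<subseteq> S" using 1(5) by (simp add: carrier_free_group)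
    show "(run \<pi> p v, x1) \<in> crossed \<pi> (f a) v" if "v \<in> V" "fst ` set p \<subseteq> S" for p v
      using cross[OF a 1(4) that] .
  qed
  have notK: "g \<otimes>\<^bsub>free_group S\<^esub> pos_word (f a) [^]\<^bsub>free_group S\<^esub> m \<otimes>\<^bsub>free_group S\<^esub> inv\<^bsub>free_group S\<^esub> g \<notin> K"
    if "g \<in> carrier (free_group S)" "m \<ge> 1" for g and m :: nat
  proof (rule conjugate_power_not_mem[OF _ perm _ _ _ fa _ that])
    show "subgroup K (free_group S)" using K(1) by (simp add: finitely_generated_subgroup_def)
    show "Inr b2 \<in> V" using 2(3) by (simp add: V_def)
    show "run \<pi> p (Inr b2) \<noteq> run \<pi> p2 (Inr b2)" if "p @ (x2, True) # q \<in> K" for p q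
      using 2(6)[OF that] by (simp add: runR)
    show "fst ` set p2 \<subseteq> S" using 2(5) by (simp add: carrier_free_group)
    show "(run \<pi> p v, x2) \<in> crossed \<pi> (f a) v" if "v \<in> V" "fst ` set p \<subseteq> S" for p v
      using cross[OF a 2(4) that] .
  qed
  have hom: "\<Phi> \<in> hom (free_group S) (free_group S)"
    and inverse: "\<And>w. w \<in> carrier (free_group S) \<Longrightarrow> \<Phi> (\<Psi> w) = w"
    using P by (auto simp: automorphism_pair_def)
  interpret Phi: group_hom "free_group S" "free_group S" \<Phi>
    by (intro group_hom.intro group_hom_axioms.intro group_free_group hom)
  have sub: "H \<subseteq> carrier (free_group S)" "K \<subseteq> carrier (free_group S)"
    using H(1) K(1) by (auto simp: finitely_generated_subgroup_def dest: subgroup.subset)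
  have al: "[(a, True)] \<in> carrier (free_group S)" using a by (simp add: letter_in_free_group)
  have "g \<otimes>\<^bsub>free_group S\<^esub> [(a, True)] [^]\<^bsub>free_group S\<^esub> m \<otimes>\<^bsub>free_group S\<^esub> inv\<^bsub>free_group S\<^esub> g \<notin> \<Psi> ` H \<union> \<Psi> ` K"
    (is "?c \<notin> _") if g: "g \<in> carrier (free_group S)" and m: "m \<ge> 1" for g and m :: nat
  proof
    assume "?c \<in> \<Psi> ` H \<union> \<Psi> ` K"
    then have "\<Phi> ?c \<in> H \<union> K" using inverse sub by auto
    moreover have "\<Phi> ?c = \<Phi> g \<otimes>\<^bsub>free_group S\<^esub> pos_word (f a) [^]\<^bsub>free_group S\<^esub> m \<otimes>\<^bsub>free_group S\<^esub> inv\<^bsub>free_group S\<^esub> \<Phi> g"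
      using g al Phi[OF a] Phi.hom_nat_pow[OF al] by (simp del: mult_free_group)
    ultimately show False using notH[of "\<Phi> g" m] notK[of "\<Phi> g" m] g m Phi.hom_closed by auto
  qed
  then show ?thesis using P by blast
qed

theorem separating_epimorphism_free_group:
  fixes S :: "'a set"
  assumes S: "finite S" "card S \<ge> 2"
    and H: "finitely_generated_subgroup H (free_group S)" "\<not> has_finite_index H (free_group S)"
    and K: "finitely_generated_subgroup K (free_group S)" "\<not> has_finite_index K (free_group S)"
  shows "\<exists>\<zeta> \<in> epi (free_group S) (free_group {0::nat, 1}). \<forall>h\<in>H. \<forall>k\<in>K. \<zeta> h = \<zeta> k \<longrightarrow> h = k"
proof -
  interpret group "free_group S" by (rule group_free_group)
  obtain a b0 where ab: "a \<in> S" "b0 \<in> S" "b0 \<noteq> a"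
  proof -
    have "\<not> card S \<le> Suc 0" using S(2) by simp
    then show thesis using that card_le_Suc0_iff_eq[OF S(1)] by blast
  qed
  obtain \<Phi> \<Psi> where P: "automorphism_pair S \<Phi> \<Psi>"
    and avoid: "\<And>g m. g \<in> carrier (free_group S) \<Longrightarrow> m \<ge> 1 \<Longrightarrow>
      g \<otimes>\<^bsub>free_group S\<^esub> [(a, True)] [^]\<^bsub>free_group S\<^esub> (m::nat) \<otimes>\<^bsub>free_group S\<^esub> inv\<^bsub>free_group S\<^esub> g \<notin> \<Psi> ` H \<union> \<Psi> ` K"
    using ex_automorphism_avoiding_powers[OF S ab(1) H K] by blast
  have hom: "\<Phi> \<in> hom (free_group S) (free_group S)" "\<Psi> \<in> hom (free_group S) (free_group S)"
    and inverse: "w \<in> carrier (free_group S) \<Longrightarrow> \<Phi> (\<Psi> w) = w" "w \<in> carrier (free_group S) \<Longrightarrow> \<Psi> (\<Phi> w) = w" for w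
    using P by (auto simp: automorphism_pair_def)
  have Psi: "group_hom (free_group S) (free_group S) \<Psi>"
    by (intro group_hom.intro group_hom_axioms.intro group_free_group hom)
  have H': "finitely_generated_subgroup (\<Psi> ` H) (free_group S)"
    and K': "finitely_generated_subgroup (\<Psi> ` K) (free_group S)"
    using finitely_generated_subgroup_image[OF Psi] H(1) K(1) by auto
  obtain M1 where M1: "M1 \<ge> 1" "\<And>N p b q. N \<ge> M1 \<Longrightarrow> p @ replicate N (a, b) @ q \<notin> \<Psi> ` H"
    using bounded_powers_in_subgroup[OF H' ab(1)] avoid by blast
  obtain M2 where M2: "M2 \<ge> 1" "\<And>N p b q. N \<ge> M2 \<Longrightarrow> p @ replicate N (a, b) @ q \<notin> \<Psi> ` K"
    using bounded_powers_in_subgroup[OF K' ab(1)] avoid by blast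
  define M where "M = max M1 M2"
  have M: "p @ replicate M (a, b) @ q \<notin> \<Psi> ` H" "p @ replicate M (a, b) @ q \<notin> \<Psi> ` K" for p b q
    using M1(2) M2(2) by (simp_all add: M_def)
  \<comment> \<open>The reduced form of a product is a prefix of the first factor followed by a
    suffix of the second, so a run of length \<open>M + M\<close> has \<open>M\<close> consecutive
    letters within one factor.\<close>
  have "M + M \<ge> 1" using M1(1) by (simp add: M_def)
  from separating_epimorphism[OF S(1) ab this] obtain \<rho> where
    rho: "\<rho> \<in> epi (free_group S) (free_group {0::nat, 1})"
    and rho_all: "\<forall>w \<in> carrier (free_group S). w \<noteq> [] \<longrightarrow>
      (\<forall>p b r. w \<noteq> p @ replicate (M + M) (a, b) @ r) \<longrightarrow> \<rho> w \<noteq> []"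
    by (rule bexE)
  have rho_ne: "\<rho> w \<noteq> []"
    if "w \<in> carrier (free_group S)" "w \<noteq> []" "\<And>p b r. w \<noteq> p @ replicate (M + M) (a, b) @ r" for w
    by (rule rho_all[rule_format, OF that(1,2)]) (rule that(3))
  have rho_hom: "\<rho> \<in> hom (free_group S) (free_group {0::nat, 1})" using rho by (simp add: epi_def)
  interpret rho: group_hom "free_group S" "free_group {0::nat, 1}" \<rho>
    by (intro group_hom.intro group_hom_axioms.intro group_free_group rho_hom)
  have sub: "H \<subseteq> carrier (free_group S)" "K \<subseteq> carrier (free_group S)"
    using H(1) K(1) by (auto simp: finitely_generated_subgroup_def dest: subgroup.subset)
  have "\<Psi> ` carrier (free_group S) = carrier (free_group S)"
    using inverse(2) hom_in_carrier[OF hom(1)] hom_in_carrier[OF hom(2)] by (metis image_subsetI subsetI subset_antisym image_eqI)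
  then have "(\<rho> \<circ> \<Psi>) ` carrier (free_group S) = carrier (free_group {0::nat, 1})"
    using rho unfolding image_comp[symmetric] by (simp add: epi_def)
  then have "\<rho> \<circ> \<Psi> \<in> epi (free_group S) (free_group {0::nat, 1})"
    unfolding epi_def using Group.hom_compose[OF hom(2) rho_hom] by blast
  moreover have "h = k" if hk: "h \<in> H" "k \<in> K" and eq: "(\<rho> \<circ> \<Psi>) h = (\<rho> \<circ> \<Psi>) k" for h k
  proof (rule ccontr)
    assume "h \<noteq> k"
    have h: "\<Psi> h \<in> carrier (free_group S)" and k: "\<Psi> k \<in> carrier (free_group S)"
      using hk sub hom_in_carrier[OF hom(2)] by blast+
    let ?w = "inv\<^bsub>free_group S\<^esub> (\<Psi> h) \<otimes>\<^bsub>free_group S\<^esub> \<Psi> k"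
    have w: "?w \<in> carrier (free_group S)" using h k by (intro m_closed inv_closed)
    have w_word: "?w = foldr push (winv (\<Psi> h)) (\<Psi> k)" using h by (simp add: inv_free_group)
    have "\<rho> ?w = \<one>\<^bsub>free_group {0::nat, 1}\<^esub>"
    proof -
      have "\<rho> ?w = inv\<^bsub>free_group {0::nat, 1}\<^esub> \<rho> (\<Psi> h) \<otimes>\<^bsub>free_group {0::nat, 1}\<^esub> \<rho> (\<Psi> k)"
        by (simp only: rho.hom_mult rho.hom_inv inv_closed h k)
      also have "\<dots> = \<one>\<^bsub>free_group {0::nat, 1}\<^esub>"
        using eq rho.H.l_inv[OF rho.hom_closed[OF k]] by (simp only: o_apply)
      finally show ?thesis .
    qed
    moreover have "?w \<noteq> \<one>\<^bsub>free_group S\<^esub>"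
    proof
      assume "?w = \<one>\<^bsub>free_group S\<^esub>"
      then have "\<Psi> h = \<Psi> k" using h k by (metis inv_equality inv_inv inv_closed)
      then have "\<Phi> (\<Psi> h) = \<Phi> (\<Psi> k)" by simp
      then show False using \<open>h \<noteq> k\<close> inverse(1) hk sub by (metis subsetD)
    qed
    ultimately obtain p b r where pr: "?w = p @ replicate (M + M) (a, b) @ r"
      using rho_ne[OF w] by auto
    have "reduced (winv (\<Psi> h))" using h by (simp add: carrier_free_group)
    then obtain u c v where uv: "winv (\<Psi> h) = u @ c" "\<Psi> k = winv c @ v" "?w = u @ v"
      unfolding w_word by (rule foldr_push_cancellation)
    have "(p @ replicate M (a, b)) @ (replicate M (a, b) @ r) = u @ v"
      using pr uv(3) by (simp add: replicate_add)
    then have "(\<exists>t. p @ replicate M (a, b) = u @ t \<and> v = t @ replicate M (a, b) @ r) \<or>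
      (\<exists>t. u = (p @ replicate M (a, b)) @ t)"
      by (subst (asm) append_eq_append_conv2) blast
    then consider t where "v = t @ replicate M (a, b) @ r" | t where "u = p @ replicate M (a, b) @ t"
      by auto
    then show False
    proof cases
      case 1
      then have "\<Psi> k = (winv c @ t) @ replicate M (a, b) @ r" using uv(2) by simp
      then show False using M(2) hk by (metis imageI)
    next
      case (2 t)
      have "subgroup (\<Psi> ` H) (free_group S)" using H' by (simp add: finitely_generated_subgroup_def)
      then have "winv (\<Psi> h) \<in> \<Psi> ` H"
        using subgroup.m_inv_closed hk(1) h by (metis imageI inv_free_group)
      moreover have "winv (\<Psi> h) = p @ replicate M (a, b) @ (t @ c)" using uv(1) 2 by simp
      ultimately show False using M(1) by metis
    qed
  qed
  ultimately show ?thesis by blast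
qed

subsection \<open>Reduction to a finite basis\<close>

text \<open>If \<open>w = b^i\<close>, then the coset of \<open>b^j\<close> depends only on
  \<open>j\<close> modulo \<open>i\<close>.\<close>

lemma subgroup_of_rank_one_has_finite_index:
  assumes "subgroup H (free_group {b})" "w \<in> H" "w \<noteq> []"
  shows "has_finite_index H (free_group {b})"
proof -
  interpret group "free_group {b}" by (rule group_free_group)
  let ?b = "[(b, True)]" and ?P = "free_group {b}"
  note H_sub = subgroup.subset[OF assms(1)]
  have b: "?b \<in> carrier ?P" by (simp add: letter_in_free_group)
  have carrier: "carrier ?P = range (\<lambda>k::int. ?b [^]\<^bsub>?P\<^esub> k)"
  proof -
    have "carrier ?P = generate ?P {?b}" using free_group_generate[of "{b}"] by simp
    then show ?thesis unfolding generate_pow[OF b] by (simp add: full_SetCompr_eq)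
  qed
  obtain i :: int where i: "w = ?b [^]\<^bsub>?P\<^esub> i" using assms(2) H_sub carrier by blast
  have i0: "i \<noteq> 0" using assms(3) i by auto
  have mem: "?b [^]\<^bsub>?P\<^esub> (i * k) \<in> H" for k :: int
  proof -
    have "w [^]\<^bsub>?P\<^esub> k \<in> H" using subgroup_int_pow_closed[OF assms(1,2)] .
    then show ?thesis unfolding i int_pow_pow[OF b] .
  qed
  \<comment> \<open>The symmetric interval covers the values of \<open>j mod i\<close> for either
    sign of \<open>i\<close>.\<close>
  have "rcosets\<^bsub>?P\<^esub> H \<subseteq> (\<lambda>r. H #>\<^bsub>?P\<^esub> (?b [^]\<^bsub>?P\<^esub> r)) ` {- \<bar>i\<bar>..\<bar>i\<bar>}"
  proof
    fix C assume "C \<in> rcosets\<^bsub>?P\<^esub> H"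
    then obtain j :: int where j: "C = H #>\<^bsub>?P\<^esub> (?b [^]\<^bsub>?P\<^esub> j)" using carrier by (auto simp: RCOSETS_def)
    let ?u = "?b [^]\<^bsub>?P\<^esub> (i * (j div i))" and ?r = "?b [^]\<^bsub>?P\<^esub> (j mod i)"
    have "?b [^]\<^bsub>?P\<^esub> j = ?u \<otimes>\<^bsub>?P\<^esub> ?r"
      using int_pow_mult[OF b, of "i * (j div i)" "j mod i"] by simp
    then have "C = (H #>\<^bsub>?P\<^esub> ?u) #>\<^bsub>?P\<^esub> ?r"
      using j coset_mult_assoc[OF H_sub, of ?u ?r] int_pow_closed[OF b] by simp
    also have "H #>\<^bsub>?P\<^esub> ?u = H" using int_pow_closed[OF b] by (intro coset_join2 assms(1) mem)
    finally have "C = H #>\<^bsub>?P\<^esub> ?r" .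
    moreover have "j mod i \<in> {- \<bar>i\<bar>..\<bar>i\<bar>}" using abs_mod_less[OF i0, of j] by auto
    ultimately show "C \<in> (\<lambda>r. H #>\<^bsub>?P\<^esub> (?b [^]\<^bsub>?P\<^esub> r)) ` {- \<bar>i\<bar>..\<bar>i\<bar>}" by blast
  qed
  then show ?thesis unfolding has_finite_index_def by (rule finite_subset) simp
qed

lemma has_finite_index_if_finite_carrier:
  assumes "finite (carrier G)"
  shows "has_finite_index H G"
  using assms by (simp add: has_finite_index_def RCOSETS_def)

lemma has_finite_index_iso_image:
  assumes "group G" "group G'" "\<theta> \<in> iso G G'" "H \<subseteq> carrier G" "has_finite_index (\<theta> ` H) G'"
  shows "has_finite_index H G"
proof -
  interpret group_hom G G' \<theta>
    using assms(1-3) by (intro group_hom.intro group_hom_axioms.intro) (auto simp: iso_def)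
  have inj: "inj_on \<theta> (carrier G)" using assms(3) by (simp add: iso_def bij_betw_def)
  have coset: "\<theta> ` (H #>\<^bsub>G\<^esub> x) = \<theta> ` H #>\<^bsub>G'\<^esub> \<theta> x" if "x \<in> carrier G" for x
    using that assms(4) by (force simp: r_coset_def image_iff)
  have "inj_on ((`) \<theta>) (rcosets\<^bsub>G\<^esub> H)"
    by (rule inj_on_subset[OF inj_on_image_Pow[OF inj]])
      (use G.r_coset_subset_G[OF assms(4)] in \<open>auto simp: RCOSETS_def\<close>)
  moreover have "(`) \<theta> ` (rcosets\<^bsub>G\<^esub> H) \<subseteq> rcosets\<^bsub>G'\<^esub> (\<theta> ` H)"
  proof
    fix D assume "D \<in> (`) \<theta> ` (rcosets\<^bsub>G\<^esub> H)"
    then obtain x where x: "x \<in> carrier G" "D = \<theta> ` (H #>\<^bsub>G\<^esub> x)" by (auto simp: RCOSETS_def)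
    then show "D \<in> rcosets\<^bsub>G'\<^esub> (\<theta> ` H)"
      unfolding RCOSETS_def using coset[OF x(1)] hom_closed[OF x(1)] by blast
  qed
  ultimately show ?thesis
    using assms(5) unfolding has_finite_index_def by (rule inj_on_finite)
qed

text \<open>With at most one basis element, infinite index would make \<open>H\<close> and
  \<open>K\<close> trivial, hence also the group they generate, in which every subgroup has finite
  index.\<close>

lemma separating_epimorphism_generated_group:
  fixes B :: "'a set"
  assumes B: "finite B"
    and H: "finitely_generated_subgroup H (free_group B)" "\<not> has_finite_index H (free_group B)"
    and K: "finitely_generated_subgroup K (free_group B)" "\<not> has_finite_index K (free_group B)"
    and gen: "generate (free_group B) (H \<union> K) = carrier (free_group B)"
  shows "\<exists>\<zeta> \<in> epi (free_group B) (free_group {0::nat, 1}). \<forall>h\<in>H. \<forall>k\<in>K. \<zeta> h = \<zeta> k \<longrightarrow> h = k"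
proof -
  interpret group "free_group B" by (rule group_free_group)
  have sub: "subgroup H (free_group B)" "subgroup K (free_group B)"
    using H(1) K(1) by (simp_all add: finitely_generated_subgroup_def)
  have "card B \<ge> 2"
  proof (rule ccontr)
    assume "\<not> card B \<ge> 2"
    then have "card B = 0 \<or> card B = Suc 0" by linarith
    then have "B = {} \<or> (\<exists>b. B = {b})" using B by (simp add: card_1_singleton_iff)
    then have "H \<union> K \<subseteq> {[]}"
    proof
      assume "B = {}"
      then have "carrier (free_group B) \<subseteq> {[]}" by (auto simp: carrier_free_group)
      then show ?thesis using subgroup.subset[OF sub(1)] subgroup.subset[OF sub(2)] by blast
    next
      assume "\<exists>b. B = {b}"
      then obtain b where b: "B = {b}" by blast
      have "w = []" if "w \<in> H \<union> K" for w
      proof (rule ccontr)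
        assume "w \<noteq> []"
        with that have "has_finite_index H (free_group {b}) \<or> has_finite_index K (free_group {b})"
          using subgroup_of_rank_one_has_finite_index[OF sub(1)[unfolded b], of w]
            subgroup_of_rank_one_has_finite_index[OF sub(2)[unfolded b], of w] by blast
        then show False using H(2) K(2) unfolding b by simp
      qed
      then show ?thesis by blast
    qed
    then have "carrier (free_group B) \<subseteq> {[]}"
      unfolding gen[symmetric] using triv_subgroup by (intro generate_subgroup_incl) simp_all
    then have "has_finite_index H (free_group B)"
      by (intro has_finite_index_if_finite_carrier) (rule finite_subset, auto)
    then show False using H(2) by simp
  qed
  then show ?thesis using separating_epimorphism_free_group[OF B _ H K] by blast
qed

text \<open>Nielsen--Schreier identifies the generated subgroup with \<open>free_group B\<close>;
  finite generation, infinite index and the generating property of \<open>H\<close> and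
  \<open>K\<close> are carried along \<open>\<theta>\<close>.\<close>

theorem corollary1p2:
  fixes F :: "('a, 'b) monoid_scheme" and H K :: "'a set"
  assumes "is_free_group F"
    and "finitely_generated_subgroup H F"
    and "finitely_generated_subgroup K F"
    and "\<not> has_finite_index H (subgroup_generated F (H \<union> K))"
    and "\<not> has_finite_index K (subgroup_generated F (H \<union> K))"
  shows "\<exists>\<zeta> \<in> epi (subgroup_generated F (H \<union> K)) (free_group {0::nat, 1}).
           inj_on \<zeta> H \<and> inj_on \<zeta> K \<and> \<zeta> ` (H \<inter> K) = \<zeta> ` H \<inter> \<zeta> ` K"
proof -
  obtain S :: "'a set" where F: "group F" and S: "F \<cong> free_group S"
    using assms(1) by (auto simp: is_free_group_def)
  interpret F: group F by (rule F)
  let ?G = "subgroup_generated F (H \<union> K)"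
  obtain A1 A2 where sub: "subgroup H F" "subgroup K F"
    and A1: "finite A1" "A1 \<subseteq> carrier F" "generate F A1 = H"
    and A2: "finite A2" "A2 \<subseteq> carrier F" "generate F A2 = K"
    using assms(2,3) by (auto simp: finitely_generated_subgroup_def)
  have HK: "H \<union> K \<subseteq> carrier F" using sub by (auto dest: subgroup.subset)
  have G_eq: "?G = F\<lparr>carrier := generate F (H \<union> K)\<rparr>"
    using HK by (simp add: subgroup_generated_def Int_absorb1)
  have G_sub: "subgroup (generate F (H \<union> K)) F" by (rule F.generate_is_subgroup[OF HK])
  have G_group: "group ?G" by (rule F.group_subgroup_generated)
  obtain \<iota> where iota: "\<iota> \<in> iso F (free_group S)" using S by (auto simp: is_iso_def)
  interpret iota: group_hom F "free_group S" \<iota>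
    using iota F group_free_group by (intro group_hom.intro group_hom_axioms.intro) (auto simp: iso_def)
  let ?G' = "(free_group S)\<lparr>carrier := \<iota> ` generate F (H \<union> K)\<rparr>"
  have iota_G: "\<iota> \<in> iso ?G ?G'"
  proof (rule isoI)
    show "\<iota> \<in> hom ?G ?G'"
      unfolding G_eq
      by (intro homI) (simp_all add: iota.hom_mult subsetD[OF subgroup.subset[OF G_sub]] del: mult_free_group)
    have "inj_on \<iota> (carrier F)" using iota by (simp add: iso_def bij_betw_def)
    then show "bij_betw \<iota> (carrier ?G) (carrier ?G')"
      unfolding G_eq using subgroup.subset[OF G_sub] by (auto simp: bij_betw_def intro: inj_on_subset)
  qed
  obtain B :: "(('a \<times> bool) list \<times> 'a) set" where "?G' \<cong> free_group B"
    using nielsen_schreier[OF iota.subgroup_img_is_subgroup[OF G_sub]] by blast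
  then obtain \<theta> where theta: "\<theta> \<in> iso ?G (free_group B)"
    using iso_set_trans[OF iota_G] by (auto simp: is_iso_def)
  interpret theta: group_hom ?G "free_group B" \<theta>
    using theta G_group group_free_group by (intro group_hom.intro group_hom_axioms.intro) (auto simp: iso_def)
  have theta_inj: "inj_on \<theta> (carrier ?G)" and theta_img: "\<theta> ` carrier ?G = carrier (free_group B)"
    using theta by (auto simp: iso_def bij_betw_def)
  have gen_G: "generate ?G Y = generate F Y" if "Y \<subseteq> generate F (H \<union> K)" for Y
    unfolding G_eq by (rule F.generate_consistent[OF that G_sub])
  have HK_G: "H \<union> K \<subseteq> generate F (H \<union> K)" by (auto intro: generate.incl)
  have fg: "finitely_generated_subgroup H ?G" "finitely_generated_subgroup K ?G"
  proof -
    have "A1 \<subseteq> H" "A2 \<subseteq> K" using A1(3) A2(3) by (auto intro: generate.incl)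
    then have "A1 \<subseteq> generate F (H \<union> K)" "A2 \<subseteq> generate F (H \<union> K)" using HK_G by blast+
    moreover have "subgroup H ?G" "subgroup K ?G"
      using sub by (auto intro: F.subgroup_of_subgroup_generated)
    ultimately show "finitely_generated_subgroup H ?G" "finitely_generated_subgroup K ?G"
      using A1 A2 gen_G unfolding finitely_generated_subgroup_def G_eq by auto
  qed
  have sub_G: "H \<subseteq> carrier ?G" "K \<subseteq> carrier ?G" using HK_G unfolding G_eq by auto
  have "finite B"
  proof (rule finite_basis_if_finitely_generated)
    let ?A = "A1 \<union> A2"
    have "A1 \<subseteq> H" "A2 \<subseteq> K" using A1(3) A2(3) by (auto intro: generate.incl)
    then have A: "?A \<subseteq> generate F (H \<union> K)" "?A \<subseteq> carrier ?G" using HK_G sub_G by blast+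
    have "H \<subseteq> generate F ?A" "K \<subseteq> generate F ?A"
      using F.mono_generate[of A1 ?A] F.mono_generate[of A2 ?A] A1(3) A2(3) by auto
    moreover have "subgroup (generate F ?A) F" using A1(2) A2(2) by (intro F.generate_is_subgroup) auto
    ultimately have "generate F (H \<union> K) \<subseteq> generate F ?A" by (intro F.generate_subgroup_incl) auto
    moreover have "generate F ?A \<subseteq> generate F (H \<union> K)" by (rule F.generate_subgroup_incl[OF A(1) G_sub])
    ultimately have "generate ?G ?A = carrier ?G"
      unfolding gen_G[OF A(1)] by (simp add: G_eq)
    then show "generate (free_group B) (\<theta> ` ?A) = carrier (free_group B)"
      using theta.generate_img[OF A(2)] theta_img by simp
    show "finite (\<theta> ` ?A)" using A1(1) A2(1) by simp
    show "\<theta> ` ?A \<subseteq> carrier (free_group B)" using A(2) theta_img by blast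
  qed
  moreover have "finitely_generated_subgroup (\<theta> ` H) (free_group B)"
    "finitely_generated_subgroup (\<theta> ` K) (free_group B)"
    using finitely_generated_subgroup_image[OF theta.group_hom_axioms] fg by blast+
  moreover have "\<not> has_finite_index (\<theta> ` H) (free_group B)" "\<not> has_finite_index (\<theta> ` K) (free_group B)"
    using has_finite_index_iso_image[OF G_group group_free_group theta] sub_G assms(4,5) by blast+
  moreover have "generate (free_group B) (\<theta> ` H \<union> \<theta> ` K) = carrier (free_group B)"
  proof -
    have "generate ?G (H \<union> K) = carrier ?G" unfolding gen_G[OF HK_G] by (simp add: G_eq)
    then show ?thesis using theta.generate_img[of "H \<union> K"] sub_G theta_img by (simp add: image_Un)
  qed
  ultimately obtain \<zeta> where zeta: "\<zeta> \<in> epi (free_group B) (free_group {0::nat, 1})"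
    and sep: "\<forall>h\<in>\<theta> ` H. \<forall>k\<in>\<theta> ` K. \<zeta> h = \<zeta> k \<longrightarrow> h = k"
    using separating_epimorphism_generated_group[of B "\<theta> ` H" "\<theta> ` K"] by blast
  have zeta_hom: "\<zeta> \<in> hom (free_group B) (free_group {0::nat, 1})"
    and zeta_img: "\<zeta> ` carrier (free_group B) = carrier (free_group {0::nat, 1})"
    using zeta by (auto simp: epi_def)
  have theta_hom: "\<theta> \<in> hom ?G (free_group B)" by (rule theta.homh)
  have "(\<zeta> \<circ> \<theta>) ` carrier ?G = carrier (free_group {0::nat, 1})"
    unfolding image_comp[symmetric] theta_img by (rule zeta_img)
  then have epi: "\<zeta> \<circ> \<theta> \<in> epi ?G (free_group {0::nat, 1})"
    unfolding epi_def using Group.hom_compose[OF theta_hom zeta_hom] by blast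
  have sep': "h = k" if "h \<in> H" "k \<in> K" "(\<zeta> \<circ> \<theta>) h = (\<zeta> \<circ> \<theta>) k" for h k
  proof -
    have "\<theta> h = \<theta> k" using sep that by simp
    then show ?thesis using inj_onD[OF theta_inj] that(1,2) sub_G by blast
  qed
  interpret zt: group_hom ?G "free_group {0::nat, 1}" "\<zeta> \<circ> \<theta>"
    by (intro group_hom.intro group_hom_axioms.intro G_group group_free_group)
      (rule Group.hom_compose[OF theta_hom zeta_hom])
  have subs: "subgroup H ?G" "subgroup K ?G" using fg by (simp_all add: finitely_generated_subgroup_def)
  have one: "\<one>\<^bsub>?G\<^esub> \<in> H" "\<one>\<^bsub>?G\<^esub> \<in> K" using subs by (blast intro: subgroup.one_closed)+
  have inj: "inj_on (\<zeta> \<circ> \<theta>) L" if L: "subgroup L ?G" and ker: "\<And>h. h \<in> L \<Longrightarrow> (\<zeta> \<circ> \<theta>) h = (\<zeta> \<circ> \<theta>) \<one>\<^bsub>?G\<^esub> \<Longrightarrow> h = \<one>\<^bsub>?G\<^esub>" for L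
  proof (rule inj_onI)
    fix x y assume xy: "x \<in> L" "y \<in> L" "(\<zeta> \<circ> \<theta>) x = (\<zeta> \<circ> \<theta>) y"
    then have car: "x \<in> carrier ?G" "y \<in> carrier ?G" using subgroup.subset[OF L] by blast+
    have "(\<zeta> \<circ> \<theta>) (x \<otimes>\<^bsub>?G\<^esub> inv\<^bsub>?G\<^esub> y) = (\<zeta> \<circ> \<theta>) x \<otimes>\<^bsub>free_group {0::nat, 1}\<^esub> inv\<^bsub>free_group {0::nat, 1}\<^esub> ((\<zeta> \<circ> \<theta>) y)"
      using car by (simp only: zt.hom_mult zt.hom_inv theta.G.inv_closed)
    also have "\<dots> = (\<zeta> \<circ> \<theta>) \<one>\<^bsub>?G\<^esub>"
      unfolding xy(3) zt.hom_one by (rule zt.H.r_inv) (rule zt.hom_closed[OF car(2)])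
    finally have "x \<otimes>\<^bsub>?G\<^esub> inv\<^bsub>?G\<^esub> y = \<one>\<^bsub>?G\<^esub>"
      using xy L by (intro ker subgroup.m_closed subgroup.m_inv_closed)
    then show "x = y" using car by (metis theta.G.inv_equality theta.G.inv_inv theta.G.inv_closed)
  qed
  \<comment> \<open>The neutral element lies in the other subgroup, so separation applied to it
    gives a trivial kernel on each of the two.\<close>
  have "inj_on (\<zeta> \<circ> \<theta>) H" using sep' one by (intro inj subs) blast
  moreover have "inj_on (\<zeta> \<circ> \<theta>) K" using sep'[OF one(1)] by (intro inj subs) metis
  moreover have "(\<zeta> \<circ> \<theta>) ` (H \<inter> K) = (\<zeta> \<circ> \<theta>) ` H \<inter> (\<zeta> \<circ> \<theta>) ` K"
    using sep' by blast
  ultimately show ?thesis using epi by blast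
qed

end
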